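(* Let $X=(X,R_X,I_X)$ and $Y=(Y,R_Y,I_Y)$ be association schemes, and let $K$ be the kernel of the group homomorphism $P:\operatorname{Aut}(X\leftthreetimes Y)\to\operatorname{Aut}(X)$ induced by the action on the set of fibers of the projection $X\times Y\to X$. For $x\in X$ let $Y_x=\{x\}\times Y$, identified with $Y$ as an association scheme via $(x,y)\mapsto y$. Then $K$ is a subgroup of $\prod_{x\in X}\operatorname{Aut}(Y_x)$. More precisely, $$K=\coprod_{\tau\in T}\Bigl(\prod_{x\in X}\operatorname{Aut}(Y_x)_\tau\Bigr),$$ where $T$ is the image of $\operatorname{Aut}(Y)$ in the group of bijections of $I_Y$ under $(g,\tau)\mapsto\tau$, and $\operatorname{Aut}(Y_x)_\tau$ denotes the set of elements of $\operatorname{Aut}(Y_x)$ whose component in the bijections of $I_Y$ is $\tau$. Here a family $(k_x,\tau)_{x\in X}$ on the right-hand side corresponds to the automorphism of $X\leftthreetimes Y$ with underlying bijection $(x,y)\mapsto (x,k_x(y))$. Consequently there is an injective group homomorphism $$\operatorname{Aut}(X\leftthreetimes Y)\hookrightarrow \operatorname{Aut}(Y)\wr_X\operatorname{Aut}(X),$$ where the right-hand side is the wreath product of groups with respect to the action of $\operatorname{Aut}(X)$ on $X$ (i.e. $\bigl(\prod_{x\in X}\operatorname{Aut}(Y)\bigr)\rtimes\operatorname{Aut}(X)$ with $\operatorname{Aut}(X)$ permuting the factors, each factor being $\operatorname{Aut}(Y_x)\cong \operatorname{Aut}(Y)$).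
   Context: Association scheme: a triple $(X,R,I)$ with $X,I$ finite sets and $R:X\times X\to I$ a surjection. For $i\in I$ let $A_i$ be the $0/1$ matrix indexed by $X\times X$ with entry $1$ exactly on $R^{-1}(i)$, and let $A_X$ be the complex linear span of the $A_i$. The requirements are: (1) there is $i_0\in I$ with $A_{i_0}$ the identity matrix; (2) $A_X$ is closed under matrix product; (3) $A_X$ is closed under transpose. The symbol $i_0$ is used for the identity relation of every scheme. Commutativity is not assumed. Morphism from $(X,R,I)$ to $(X',R',I')$: a pair of maps $f:X\to X'$, $\sigma:I\to I'$ with $R'(f(x),f(y))=\sigma(R(x,y))$ for all $x,y\in X$. $\operatorname{Aut}(X)$ is the group of automorphisms $(f,\sigma)$ in this category (both $f$ and $\sigma$ bijective; $\sigma$ need not be the identity). Since $R$ is surjective, $f$ determines $\sigma$. Wreath product: $I_X\leftthreetimes I_Y:=(I_X\setminus\{i_0\})\coprod I_Y$. The scheme $X\leftthreetimes Y$ has underlying set $X\times Y$, relation set $I_X\leftthreetimes I_Y$, and $R_{\leftthreetimes}((x,y),(x',y'))=R_X(x,x')\in I_X\setminus\{i_0\}$ if $x\neq x'$, and $=R_Y(y,y')\in I_Y$ if $x=x'$. This is an association scheme. The homomorphism $P$: for every $(f,\tau)\in\operatorname{Aut}(X\leftthreetimes Y)$, $f$ permutes the fibers of the projection $p:X\times Y\to X$, so there is a bijection $\pi(f):X\to X$ with $p\circ f=\pi(f)\circ p$; it is the first component of a unique element of $\operatorname{Aut}(X)$, and $P(f,\tau)$ is that element. *)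

theory Defs
  imports Complex_Main "HOL-Library.Disjoint_Sets" "HOL-Algebra.Product_Groups" "HOL-Algebra.Group_Action"
begin

section \<open>Association schemes\<close>

text \<open>Only the values of \<open>rel\<close> on \<open>points \<times> points\<close> matter.\<close>

record ('x, 'i) rel_triple =
  points :: "'x set"
  rel :: "'x \<Rightarrow> 'x \<Rightarrow> 'i"
  inds :: "'i set"

text \<open>Complex matrices indexed by \<open>points S \<times> points S\<close> are functions vanishing outside this set.\<close>

definition adj :: "('x, 'i) rel_triple \<Rightarrow> 'i \<Rightarrow> 'x \<Rightarrow> 'x \<Rightarrow> complex" where
  "adj S i = (\<lambda>x y. if x \<in> points S \<and> y \<in> points S \<and> rel S x y = i then 1 else 0)"

definition id_matrix :: "('x, 'i) rel_triple \<Rightarrow> 'x \<Rightarrow> 'x \<Rightarrow> complex" where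
  "id_matrix S = (\<lambda>x y. if x \<in> points S \<and> x = y then 1 else 0)"

definition adj_span :: "('x, 'i) rel_triple \<Rightarrow> ('x \<Rightarrow> 'x \<Rightarrow> complex) set" where
  "adj_span S = {M. \<exists>c. M = (\<lambda>x y. \<Sum>i\<in>inds S. c i * adj S i x y)}"

definition matrix_prod ::
  "('x, 'i) rel_triple \<Rightarrow> ('x \<Rightarrow> 'x \<Rightarrow> complex) \<Rightarrow> ('x \<Rightarrow> 'x \<Rightarrow> complex) \<Rightarrow> 'x \<Rightarrow> 'x \<Rightarrow> complex" where
  "matrix_prod S M N = (\<lambda>x y. \<Sum>z\<in>points S. M x z * N z y)"

locale association_scheme =
  fixes S :: "('x, 'i) rel_triple"
  assumes finite_points: "finite (points S)"
    and finite_inds: "finite (inds S)"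
    and rel_surj: "(\<lambda>(x, y). rel S x y) ` (points S \<times> points S) = inds S"
    and ex_id_index: "\<exists>i\<in>inds S. adj S i = id_matrix S"
    and prod_closed: "\<And>M N. M \<in> adj_span S \<Longrightarrow> N \<in> adj_span S \<Longrightarrow> matrix_prod S M N \<in> adj_span S"
    and transpose_closed: "\<And>M. M \<in> adj_span S \<Longrightarrow> (\<lambda>x y. M y x) \<in> adj_span S"

text \<open>The relation \<open>i\<^sub>0\<close>; it is unique for an association scheme (\<open>id_index_unique\<close> below).\<close>

definition id_index :: "('x, 'i) rel_triple \<Rightarrow> 'i" where
  "id_index S = (THE i. i \<in> inds S \<and> adj S i = id_matrix S)"

text \<open>Both components of a morphism are extensional, so that equality of morphisms is
  equality of maps on \<open>points\<close> and \<open>inds\<close>.\<close>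

definition scheme_morphisms ::
  "('x, 'i) rel_triple \<Rightarrow> ('y, 'j) rel_triple \<Rightarrow> (('x \<Rightarrow> 'y) \<times> ('i \<Rightarrow> 'j)) set" where
  "scheme_morphisms S S' = {(f, \<sigma>). f \<in> points S \<rightarrow>\<^sub>E points S' \<and> \<sigma> \<in> inds S \<rightarrow>\<^sub>E inds S' \<and>
     (\<forall>x\<in>points S. \<forall>y\<in>points S. rel S' (f x) (f y) = \<sigma> (rel S x y))}"

definition Aut :: "('x, 'i) rel_triple \<Rightarrow> (('x \<Rightarrow> 'x) \<times> ('i \<Rightarrow> 'i)) monoid" where
  "Aut S = (BijGroup (points S) \<times>\<times> BijGroup (inds S))
     \<lparr>carrier := {(f, \<sigma>) \<in> scheme_morphisms S S.
        bij_betw f (points S) (points S) \<and> bij_betw \<sigma> (inds S) (inds S)}\<rparr>"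

definition Aut_over :: "('x, 'i) rel_triple \<Rightarrow> ('i \<Rightarrow> 'i) \<Rightarrow> (('x \<Rightarrow> 'x) \<times> ('i \<Rightarrow> 'i)) set" where
  "Aut_over S \<tau> = {\<phi> \<in> carrier (Aut S). snd \<phi> = \<tau>}"


section \<open>The wreath product of schemes\<close>

definition wreath_scheme ::
  "('x, 'i) rel_triple \<Rightarrow> ('y, 'j) rel_triple \<Rightarrow> ('x \<times> 'y, 'i + 'j) rel_triple" where
  "wreath_scheme X Y =
     \<lparr>points = points X \<times> points Y,
      rel = (\<lambda>(x, y) (x', y'). if x \<noteq> x' then Inl (rel X x x') else Inr (rel Y y y')),
      inds = (inds X - {id_index X}) <+> inds Y\<rparr>"

text \<open>The scheme \<open>Y\<^sub>x\<close> on the fibre \<open>{x} \<times> Y\<close>, and the identification of \<open>Aut Y\<^sub>x\<close> with \<open>Aut Y\<close>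
  along \<open>(x, y) \<mapsto> y\<close>.\<close>

definition fibre :: "('y, 'j) rel_triple \<Rightarrow> 'x \<Rightarrow> ('x \<times> 'y, 'j) rel_triple" where
  "fibre Y x = \<lparr>points = {x} \<times> points Y, rel = (\<lambda>z z'. rel Y (snd z) (snd z')), inds = inds Y\<rparr>"

definition fibre_ident ::
  "('y, 'j) rel_triple \<Rightarrow> 'x \<Rightarrow> (('x \<times> 'y \<Rightarrow> 'x \<times> 'y) \<times> ('j \<Rightarrow> 'j)) \<Rightarrow> (('y \<Rightarrow> 'y) \<times> ('j \<Rightarrow> 'j))" where
  "fibre_ident Y x = (\<lambda>(g, \<tau>). ((\<lambda>y\<in>points Y. snd (g (x, y))), \<tau>))"

text \<open>The homomorphism \<open>P\<close>: the element of \<open>Aut X\<close> whose first component \<open>\<pi>\<close> satisfies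
  \<open>p \<circ> f = \<pi> \<circ> p\<close> for the projection \<open>p\<close>.  It is well defined by \<open>ex1_base_aut\<close> below.\<close>

definition base_aut ::
  "('x, 'i) rel_triple \<Rightarrow> ('y, 'j) rel_triple \<Rightarrow>
   (('x \<times> 'y \<Rightarrow> 'x \<times> 'y) \<times> ('i + 'j \<Rightarrow> 'i + 'j)) \<Rightarrow> (('x \<Rightarrow> 'x) \<times> ('i \<Rightarrow> 'i))" where
  "base_aut X Y \<phi> = (THE g. g \<in> carrier (Aut X) \<and>
     (\<forall>z\<in>points (wreath_scheme X Y). fst (fst \<phi> z) = fst g (fst z)))"

definition base_kernel ::
  "('x, 'i) rel_triple \<Rightarrow> ('y, 'j) rel_triple \<Rightarrow>
   (('x \<times> 'y \<Rightarrow> 'x \<times> 'y) \<times> ('i + 'j \<Rightarrow> 'i + 'j)) set" where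
  "base_kernel X Y = kernel (Aut (wreath_scheme X Y)) (Aut X) (base_aut X Y)"

definition index_bijections :: "('y, 'j) rel_triple \<Rightarrow> ('j \<Rightarrow> 'j) set" where
  "index_bijections Y = snd ` carrier (Aut Y)"

definition fibre_aut_families ::
  "('x, 'i) rel_triple \<Rightarrow> ('y, 'j) rel_triple \<Rightarrow> ('j \<Rightarrow> 'j) \<Rightarrow>
   ('x \<Rightarrow> (('x \<times> 'y \<Rightarrow> 'x \<times> 'y) \<times> ('j \<Rightarrow> 'j))) set" where
  "fibre_aut_families X Y \<tau> = (\<Pi>\<^sub>E x\<in>points X. Aut_over (fibre Y x) \<tau>)"


section \<open>The wreath product of groups\<close>

definition semidirect_product ::
  "('n, 'a) monoid_scheme \<Rightarrow> ('h, 'b) monoid_scheme \<Rightarrow> ('h \<Rightarrow> 'n \<Rightarrow> 'n) \<Rightarrow> ('n \<times> 'h) monoid" where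
  "semidirect_product N H \<theta> =
     \<lparr>carrier = carrier N \<times> carrier H,
      mult = (\<lambda>(n, h) (n', h'). (n \<otimes>\<^bsub>N\<^esub> \<theta> h n', h \<otimes>\<^bsub>H\<^esub> h')),
      one = (\<one>\<^bsub>N\<^esub>, \<one>\<^bsub>H\<^esub>)\<rparr>"

text \<open>\<open>G \<wr>\<^sub>\<Omega> H\<close> for an action \<open>\<alpha>\<close> of \<open>H\<close> on \<open>\<Omega>\<close>: the element \<open>h\<close> moves the factor at \<open>\<omega>\<close> to the
  factor at \<open>\<alpha> h \<omega>\<close>.\<close>

definition wreath_group ::
  "('g, 'a) monoid_scheme \<Rightarrow> 'x set \<Rightarrow> ('h, 'b) monoid_scheme \<Rightarrow> ('h \<Rightarrow> 'x \<Rightarrow> 'x) \<Rightarrow>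
   (('x \<Rightarrow> 'g) \<times> 'h) monoid" where
  "wreath_group G \<Omega> H \<alpha> =
     semidirect_product (product_group \<Omega> (\<lambda>_. G)) H (\<lambda>h k. \<lambda>\<omega>\<in>\<Omega>. k (\<alpha> (inv\<^bsub>H\<^esub> h) \<omega>))"


section \<open>Well-definedness\<close>

lemma (in association_scheme) inds_rel:
  assumes "i \<in> inds S"
  obtains x y where "x \<in> points S" "y \<in> points S" "rel S x y = i"
  using assms unfolding rel_surj[symmetric] by auto

lemma (in association_scheme) ex1_id_index: "\<exists>!i. i \<in> inds S \<and> adj S i = id_matrix S"
proof -
  obtain i where i: "i \<in> inds S" "adj S i = id_matrix S"
    using ex_id_index by blast
  have "j = i" if j: "j \<in> inds S" "adj S j = id_matrix S" for j
  proof -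
    obtain x y where xy: "x \<in> points S" "y \<in> points S" "rel S x y = j"
      using j(1) by (rule inds_rel)
    then have "adj S i x y = 1"
      using i j by (simp add: adj_def fun_eq_iff) metis
    then show "j = i"
      using xy by (auto simp: adj_def split: if_splits)
  qed
  with i show ?thesis by blast
qed

lemma (in association_scheme) id_index:
  shows id_index_in: "id_index S \<in> inds S"
    and adj_id_index: "adj S (id_index S) = id_matrix S"
  using theI'[OF ex1_id_index] by (auto simp: id_index_def)

lemma (in association_scheme) id_index_unique:
  "i \<in> inds S \<Longrightarrow> adj S i = id_matrix S \<Longrightarrow> i = id_index S"
  using ex1_id_index id_index by blast

lemma (in association_scheme) rel_eq_id_index_iff:
  assumes "x \<in> points S" "y \<in> points S"
  shows "rel S x y = id_index S \<longleftrightarrow> x = y"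
proof -
  have "adj S (id_index S) x y = id_matrix S x y"
    by (simp add: adj_id_index)
  with assms show ?thesis
    by (auto simp: adj_def id_matrix_def split: if_splits)
qed

lemma (in association_scheme) rel_in: "x \<in> points S \<Longrightarrow> y \<in> points S \<Longrightarrow> rel S x y \<in> inds S"
  using rel_surj by force

lemma (in association_scheme) points_nonempty: "points S \<noteq> {}"
  using rel_surj id_index_in by auto

lemma in_Aut_iff:
  "(f, \<sigma>) \<in> carrier (Aut S) \<longleftrightarrow> f \<in> Bij (points S) \<and> \<sigma> \<in> Bij (inds S) \<and>
     (\<forall>x\<in>points S. \<forall>y\<in>points S. rel S (f x) (f y) = \<sigma> (rel S x y))"
  by (auto simp: Aut_def scheme_morphisms_def Bij_def PiE_def dest: bij_betw_apply)

lemma AutD: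
  assumes "(f, \<sigma>) \<in> carrier (Aut S)"
  shows "bij_betw f (points S) (points S)" "bij_betw \<sigma> (inds S) (inds S)"
    "\<And>x y. x \<in> points S \<Longrightarrow> y \<in> points S \<Longrightarrow> rel S (f x) (f y) = \<sigma> (rel S x y)"
  using assms by (auto simp: in_Aut_iff Bij_def)

lemma Aut_mult:
  assumes "(f, \<sigma>) \<in> carrier (Aut S)" "(g, \<tau>) \<in> carrier (Aut S)"
  shows "(f, \<sigma>) \<otimes>\<^bsub>Aut S\<^esub> (g, \<tau>) = (compose (points S) f g, compose (inds S) \<sigma> \<tau>)"
  using assms by (simp add: in_Aut_iff) (simp add: Aut_def DirProd_def BijGroup_def)

lemma Aut_one: "\<one>\<^bsub>Aut S\<^esub> = (\<lambda>x\<in>points S. x, \<lambda>i\<in>inds S. i)"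
  by (simp add: Aut_def DirProd_def BijGroup_def)

lemma (in association_scheme) group_Aut: "group (Aut S)"
proof -
  let ?G = "BijGroup (points S) \<times>\<times> BijGroup (inds S)"
  interpret G: group ?G
    by (intro DirProd_group group_BijGroup)
  have carr: "carrier (Aut S) \<subseteq> carrier ?G"
    by (auto simp: in_Aut_iff DirProd_def BijGroup_def)
  have "subgroup (carrier (Aut S)) ?G"
  proof (rule G.subgroupI)
    show "carrier (Aut S) \<subseteq> carrier ?G" by (rule carr)
    have "(\<lambda>x\<in>points S. x, \<lambda>i\<in>inds S. i) \<in> carrier (Aut S)"
      by (auto simp: in_Aut_iff id_Bij rel_in)
    then show "carrier (Aut S) \<noteq> {}" by blast
  next
    fix a b assume a: "a \<in> carrier (Aut S)" and b: "b \<in> carrier (Aut S)"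
    obtain f \<sigma> g \<tau> where [simp]: "a = (f, \<sigma>)" "b = (g, \<tau>)" by (cases a, cases b)
    have "(compose (points S) f g, compose (inds S) \<sigma> \<tau>) \<in> carrier (Aut S)"
      using a b unfolding \<open>a = (f, \<sigma>)\<close> \<open>b = (g, \<tau>)\<close> in_Aut_iff
      by (auto simp: compose_Bij compose_eq rel_in Bij_imp_funcset[THEN funcset_mem])
    moreover have "a \<otimes>\<^bsub>?G\<^esub> b = a \<otimes>\<^bsub>Aut S\<^esub> b"
      by (simp add: Aut_def)
    ultimately show "a \<otimes>\<^bsub>?G\<^esub> b \<in> carrier (Aut S)"
      using Aut_mult[of f \<sigma> S g \<tau>] a b by simp
  next
    fix a assume a: "a \<in> carrier (Aut S)"
    obtain f \<sigma> where [simp]: "a = (f, \<sigma>)" by (cases a)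
    define f' where "f' = (\<lambda>x\<in>points S. inv_into (points S) f x)"
    define \<sigma>' where "\<sigma>' = (\<lambda>x\<in>inds S. inv_into (inds S) \<sigma> x)"
    have f: "f \<in> Bij (points S)" and s: "\<sigma> \<in> Bij (inds S)"
      using a by (auto simp: in_Aut_iff)
    have "rel S (f' x) (f' y) = \<sigma>' (rel S x y)" if x: "x \<in> points S" and y: "y \<in> points S" for x y
    proof -
      from f have bf: "bij_betw f (points S) (points S)" by (simp add: Bij_def)
      obtain u v where u: "u \<in> points S" "x = f u" and v: "v \<in> points S" "y = f v"
        using bf x y by (metis bij_betw_imp_surj_on imageE)
      have fu: "f' x = u" "f' y = v"
        using u v x y bf by (auto simp: f'_def bij_betw_inv_into_left)
      have "rel S x y = \<sigma> (rel S u v)"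
        using a u v by (simp add: in_Aut_iff)
      moreover have "rel S x y \<in> inds S" "rel S u v \<in> inds S"
        using x y u v rel_in by auto
      ultimately have "\<sigma>' (rel S x y) = rel S u v"
        using s by (auto simp: \<sigma>'_def Bij_def bij_betw_def)
      then show ?thesis by (simp add: fu)
    qed
    then have inv_in: "(f', \<sigma>') \<in> carrier (Aut S)"
      using f s by (auto simp: in_Aut_iff f'_def \<sigma>'_def restrict_inv_into_Bij)
    have "(f', \<sigma>') \<otimes>\<^bsub>?G\<^esub> a = (f', \<sigma>') \<otimes>\<^bsub>Aut S\<^esub> a"
      by (simp add: Aut_def)
    also have "\<dots> = \<one>\<^bsub>?G\<^esub>"
      using Aut_mult[OF inv_in, of f \<sigma>] a f s
      by (simp add: f'_def \<sigma>'_def Bij_compose_restrict_eq) (simp add: DirProd_def BijGroup_def)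
    finally have "inv\<^bsub>?G\<^esub> a = (f', \<sigma>')"
      using a inv_in carr by (intro G.inv_equality) auto
    then show "inv\<^bsub>?G\<^esub> a \<in> carrier (Aut S)"
      using inv_in by simp
  qed
  then have "group (?G\<lparr>carrier := carrier (Aut S)\<rparr>)"
    by (rule G.subgroup_imp_group)
  then show ?thesis
    by (simp add: Aut_def)
qed

lemma (in association_scheme) Aut_eqI:
  assumes "\<phi> \<in> carrier (Aut S)" "\<psi> \<in> carrier (Aut S)"
    and "\<And>x. x \<in> points S \<Longrightarrow> fst \<phi> x = fst \<psi> x"
  shows "\<phi> = \<psi>"
proof -
  obtain f \<sigma> g \<tau> where [simp]: "\<phi> = (f, \<sigma>)" "\<psi> = (g, \<tau>)" by (cases \<phi>, cases \<psi>)
  have a: "f \<in> extensional (points S)" "g \<in> extensional (points S)"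
     "\<sigma> \<in> extensional (inds S)" "\<tau> \<in> extensional (inds S)"
    using assms by (auto simp: in_Aut_iff Bij_def)
  have fg: "f = g"
    using a assms(3) by (auto intro: extensionalityI)
  have "\<sigma> i = \<tau> i" if i: "i \<in> inds S" for i
  proof -
    obtain x y where "x \<in> points S" "y \<in> points S" "rel S x y = i"
      using i by (rule inds_rel)
    with assms(1,2) fg show ?thesis
      by (auto simp: in_Aut_iff)
  qed
  then have "\<sigma> = \<tau>"
    using a by (auto intro: extensionalityI)
  with fg show ?thesis by simp
qed

text \<open>A bijection of the points compatible with some map of relations gives an automorphism.\<close>

lemma (in association_scheme) AutI:
  assumes f: "bij_betw f (points S) (points S)" and ext: "f \<in> extensional (points S)"
    and s: "\<sigma> \<in> extensional (inds S)"
    and r: "\<And>x y. x \<in> points S \<Longrightarrow> y \<in> points S \<Longrightarrow> rel S (f x) (f y) = \<sigma> (rel S x y)"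
  shows "(f, \<sigma>) \<in> carrier (Aut S)"
proof -
  have "\<sigma> ` inds S = inds S"
  proof (intro equalityI subsetI)
    fix i assume "i \<in> \<sigma> ` inds S"
    then obtain j where j: "j \<in> inds S" "i = \<sigma> j" by blast
    obtain x y where xy: "x \<in> points S" "y \<in> points S" "rel S x y = j"
      using j(1) by (rule inds_rel)
    then have "i = rel S (f x) (f y)" using r j(2) by simp
    then show "i \<in> inds S"
      using rel_in bij_betw_apply[OF f] xy by simp
  next
    fix i assume "i \<in> inds S"
    then obtain x y where xy: "x \<in> points S" "y \<in> points S" "rel S x y = i"
      by (rule inds_rel)
    obtain u where u: "u \<in> points S" "x = f u"
      using bij_betw_imp_surj_on[OF f] xy(1) by blast
    obtain v where v: "v \<in> points S" "y = f v"
      using bij_betw_imp_surj_on[OF f] xy(2) by blast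
    have "i = \<sigma> (rel S u v)" using r[OF u(1) v(1)] u v xy by simp
    then show "i \<in> \<sigma> ` inds S"
      using rel_in u v by blast
  qed
  then have "bij_betw \<sigma> (inds S) (inds S)"
    using finite_inds by (simp add: bij_betw_def eq_card_imp_inj_on)
  then show ?thesis
    unfolding in_Aut_iff Bij_def using f ext s r by blast
qed

lemma wreath_scheme_simps [simp]:
  "points (wreath_scheme X Y) = points X \<times> points Y"
  "inds (wreath_scheme X Y) = (inds X - {id_index X}) <+> inds Y"
  "rel (wreath_scheme X Y) z z' =
     (if fst z \<noteq> fst z' then Inl (rel X (fst z) (fst z')) else Inr (rel Y (snd z) (snd z')))"
  by (auto simp: wreath_scheme_def split: prod.splits)

lemma fibre_simps [simp]:
  "points (fibre Y x) = {x} \<times> points Y"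
  "inds (fibre Y x) = inds Y"
  "rel (fibre Y x) z z' = rel Y (snd z) (snd z')"
  by (auto simp: fibre_def)

lemma adj_span_iff:
  assumes "finite (inds S)" and surj: "(\<lambda>(x, y). rel S x y) ` (points S \<times> points S) = inds S"
  shows "M \<in> adj_span S \<longleftrightarrow>
    (\<exists>c. \<forall>x y. M x y = (if x \<in> points S \<and> y \<in> points S then c (rel S x y) else 0))"
proof -
  have "(\<Sum>i\<in>inds S. c i * adj S i x y)
      = (if x \<in> points S \<and> y \<in> points S then c (rel S x y) else 0)" for c x y
  proof (cases "x \<in> points S \<and> y \<in> points S")
    case True
    then have "rel S x y \<in> inds S"
      using surj by force
    have "(\<Sum>i\<in>inds S. c i * adj S i x y) = (\<Sum>i\<in>inds S. if rel S x y = i then c i else 0)"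
      using True by (intro sum.cong) (auto simp: adj_def)
    also have "\<dots> = c (rel S x y)"
      using \<open>finite (inds S)\<close> \<open>rel S x y \<in> inds S\<close> by simp
    finally show ?thesis using True by simp
  qed (auto simp: adj_def intro!: sum.neutral)
  then show ?thesis
    by (auto simp: adj_span_def fun_eq_iff)
qed

lemma (in association_scheme) in_adj_span_iff:
  "M \<in> adj_span S \<longleftrightarrow>
    (\<exists>c. \<forall>x y. M x y = (if x \<in> points S \<and> y \<in> points S then c (rel S x y) else 0))"
  by (rule adj_span_iff[OF finite_inds rel_surj])

lemma (in association_scheme) colsum_const:
  "\<exists>s. \<forall>y\<in>points S. (\<Sum>z\<in>points S. c (rel S z y)) = (s :: complex)"
proof -
  let ?N = "\<lambda>x y. if x \<in> points S \<and> y \<in> points S then c (rel S x y) else 0"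
  let ?J = "\<lambda>x y. if x \<in> points S \<and> y \<in> points S then 1 else (0::complex)"
  have "?J \<in> adj_span S"
    unfolding in_adj_span_iff by (rule exI[of _ "\<lambda>_. 1"]) simp
  moreover have "?N \<in> adj_span S"
    unfolding in_adj_span_iff by blast
  ultimately have "matrix_prod S ?J ?N \<in> adj_span S"
    by (rule prod_closed)
  then obtain d where d: "\<And>x y. matrix_prod S ?J ?N x y =
      (if x \<in> points S \<and> y \<in> points S then d (rel S x y) else 0)"
    unfolding in_adj_span_iff by blast
  have "(\<Sum>z\<in>points S. c (rel S z y)) = d (id_index S)" if "y \<in> points S" for y
    using d[of y y] that rel_eq_id_index_iff[of y y] by (simp add: matrix_prod_def)
  then show ?thesis by blast
qed

lemma (in association_scheme) rowsum_const:
  "\<exists>s. \<forall>y\<in>points S. (\<Sum>z\<in>points S. c (rel S y z)) = (s :: complex)"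
proof -
  let ?N = "\<lambda>x y. if x \<in> points S \<and> y \<in> points S then c (rel S x y) else 0"
  have "?N \<in> adj_span S"
    unfolding in_adj_span_iff by blast
  then have "(\<lambda>x y. ?N y x) \<in> adj_span S"
    by (rule transpose_closed)
  then obtain d where d: "\<And>x y. ?N y x = (if x \<in> points S \<and> y \<in> points S then d (rel S x y) else 0)"
    unfolding in_adj_span_iff by blast
  obtain s where s: "\<And>y. y \<in> points S \<Longrightarrow> (\<Sum>z\<in>points S. d (rel S z y)) = s"
    using colsum_const[of d] by blast
  have "(\<Sum>z\<in>points S. c (rel S y z)) = s" if "y \<in> points S" for y
  proof -
    have "(\<Sum>z\<in>points S. c (rel S y z)) = (\<Sum>z\<in>points S. d (rel S z y))"
    proof (rule sum.cong[OF refl])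
      fix z assume "z \<in> points S"
      then show "c (rel S y z) = d (rel S z y)"
        using d[of y z] that by simp
    qed
    then show ?thesis using s that by simp
  qed
  then show ?thesis by blast
qed

locale scheme_pair = X: association_scheme X + Y: association_scheme Y
  for X :: "('x, 'i) rel_triple" and Y :: "('y, 'j) rel_triple"
begin

abbreviation "W \<equiv> wreath_scheme X Y"

lemma wreath_rel_surj: "(\<lambda>(x, y). rel W x y) ` (points W \<times> points W) = inds W"
proof (intro equalityI subsetI)
  fix i assume "i \<in> (\<lambda>(x, y). rel W x y) ` (points W \<times> points W)"
  then show "i \<in> inds W"
    using X.rel_in Y.rel_in X.rel_eq_id_index_iff by auto
next
  fix i assume i: "i \<in> inds W"
  obtain x0 y0 where x0: "x0 \<in> points X" and y0: "y0 \<in> points Y"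
    using X.points_nonempty Y.points_nonempty by blast
  from i consider (l) a where "i = Inl a" "a \<in> inds X" "a \<noteq> id_index X" | (r) b where "i = Inr b" "b \<in> inds Y"
    by auto
  then show "i \<in> (\<lambda>(x, y). rel W x y) ` (points W \<times> points W)"
  proof cases
    case l
    then obtain x x' where x: "x \<in> points X" "x' \<in> points X" "a = rel X x x'"
      using X.rel_surj by force
    then have "x \<noteq> x'"
      using l X.rel_eq_id_index_iff by blast
    then show ?thesis
      using x y0 l by (intro image_eqI[of _ _ "((x, y0), (x', y0))"]) auto
  next
    case r
    then obtain y y' where y: "y \<in> points Y" "y' \<in> points Y" "b = rel Y y y'"
      using Y.rel_surj by force
    then show ?thesis
      using x0 r by (intro image_eqI[of _ _ "((x0, y), (x0, y'))"]) auto
  qed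
qed

sublocale W: association_scheme "wreath_scheme X Y"
proof
  show fp: "finite (points W)"
    using X.finite_points Y.finite_points by simp
  show fi: "finite (inds W)"
    using X.finite_inds Y.finite_inds by simp
  show surj: "(\<lambda>(x, y). rel W x y) ` (points W \<times> points W) = inds W"
    by (rule wreath_rel_surj)
  show "\<exists>i\<in>inds W. adj W i = id_matrix W"
  proof
    show "Inr (id_index Y) \<in> inds W" using Y.id_index_in by auto
    show "adj W (Inr (id_index Y)) = id_matrix W"
      by (auto simp: adj_def id_matrix_def fun_eq_iff Y.rel_eq_id_index_iff)
  qed
  note iff = adj_span_iff[OF fi surj]
  show "(\<lambda>x y. M y x) \<in> adj_span W" if M: "M \<in> adj_span W" for M
  proof -
    obtain c where c: "\<And>x y. M x y = (if x \<in> points W \<and> y \<in> points W then c (rel W x y) else 0)"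
      using M unfolding iff by blast
    have "(\<lambda>x y. if x \<in> points X \<and> y \<in> points X then c (Inl (rel X x y)) else 0) \<in> adj_span X"
      unfolding X.in_adj_span_iff by (rule exI[of _ "\<lambda>i. c (Inl i)"]) simp
    from X.transpose_closed[OF this] obtain d1 where
      d1: "\<And>x y. (if y \<in> points X \<and> x \<in> points X then c (Inl (rel X y x)) else 0)
        = (if x \<in> points X \<and> y \<in> points X then d1 (rel X x y) else 0)"
      unfolding X.in_adj_span_iff by blast
    have "(\<lambda>x y. if x \<in> points Y \<and> y \<in> points Y then c (Inr (rel Y x y)) else 0) \<in> adj_span Y"
      unfolding Y.in_adj_span_iff by (rule exI[of _ "\<lambda>i. c (Inr i)"]) simp
    from Y.transpose_closed[OF this] obtain d2 where
      d2: "\<And>x y. (if y \<in> points Y \<and> x \<in> points Y then c (Inr (rel Y y x)) else 0)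
        = (if x \<in> points Y \<and> y \<in> points Y then d2 (rel Y x y) else 0)"
      unfolding Y.in_adj_span_iff by blast
    have "M z' z = (if z \<in> points W \<and> z' \<in> points W then case_sum d1 d2 (rel W z z') else 0)" for z z'
      using c[of z' z] d1[of "fst z'" "fst z"] d2[of "snd z'" "snd z"] 
      by (auto simp: mem_Times_iff)
    then show ?thesis
      unfolding iff by blast
  qed
  show "matrix_prod W M N \<in> adj_span W" if M: "M \<in> adj_span W" and N: "N \<in> adj_span W" for M N
  proof -
    obtain c where c: "\<And>x y. M x y = (if x \<in> points W \<and> y \<in> points W then c (rel W x y) else 0)"
      using M unfolding iff by blast
    obtain d where d: "\<And>x y. N x y = (if x \<in> points W \<and> y \<in> points W then d (rel W x y) else 0)"
      using N unfolding iff by blast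
    define cX where "cX i = (if i = id_index X then 0 else c (Inl i))" for i
    define dX where "dX i = (if i = id_index X then 0 else d (Inl i))" for i
    have "(\<lambda>x y. if x \<in> points X \<and> y \<in> points X then cX (rel X x y) else 0) \<in> adj_span X"
      "(\<lambda>x y. if x \<in> points X \<and> y \<in> points X then dX (rel X x y) else 0) \<in> adj_span X"
      unfolding X.in_adj_span_iff by blast+
    from X.prod_closed[OF this] obtain e where
      e': "\<And>x y. (\<Sum>z\<in>points X. (if x \<in> points X \<and> z \<in> points X then cX (rel X x z) else 0) *
            (if z \<in> points X \<and> y \<in> points X then dX (rel X z y) else 0))
        = (if x \<in> points X \<and> y \<in> points X then e (rel X x y) else 0)"
      unfolding X.in_adj_span_iff matrix_prod_def by blast
    then have e: "(\<Sum>z\<in>points X. cX (rel X x z) * dX (rel X z y)) = e (rel X x y)"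
      if "x \<in> points X" "y \<in> points X" for x y
    proof -
      have "(\<Sum>z\<in>points X. cX (rel X x z) * dX (rel X z y)) =
        (\<Sum>z\<in>points X. (if x \<in> points X \<and> z \<in> points X then cX (rel X x z) else 0) *
            (if z \<in> points X \<and> y \<in> points X then dX (rel X z y) else 0))"
        using that by (intro sum.cong) auto
      then show ?thesis
        unfolding e' using that by simp
    qed
    have "(\<lambda>x y. if x \<in> points Y \<and> y \<in> points Y then c (Inr (rel Y x y)) else 0) \<in> adj_span Y"
      "(\<lambda>x y. if x \<in> points Y \<and> y \<in> points Y then d (Inr (rel Y x y)) else 0) \<in> adj_span Y"
      unfolding Y.in_adj_span_iff
      by (rule exI[of _ "\<lambda>i. c (Inr i)"], simp, rule exI[of _ "\<lambda>i. d (Inr i)"], simp)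
    from Y.prod_closed[OF this] obtain g where
      g': "\<And>x y. (\<Sum>z\<in>points Y. (if x \<in> points Y \<and> z \<in> points Y then c (Inr (rel Y x z)) else 0) *
            (if z \<in> points Y \<and> y \<in> points Y then d (Inr (rel Y z y)) else 0))
        = (if x \<in> points Y \<and> y \<in> points Y then g (rel Y x y) else 0)"
      unfolding Y.in_adj_span_iff matrix_prod_def by blast
    then have g: "(\<Sum>z\<in>points Y. c (Inr (rel Y x z)) * d (Inr (rel Y z y))) = g (rel Y x y)"
      if "x \<in> points Y" "y \<in> points Y" for x y
    proof -
      have "(\<Sum>z\<in>points Y. c (Inr (rel Y x z)) * d (Inr (rel Y z y))) =
        (\<Sum>z\<in>points Y. (if x \<in> points Y \<and> z \<in> points Y then c (Inr (rel Y x z)) else 0) *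
            (if z \<in> points Y \<and> y \<in> points Y then d (Inr (rel Y z y)) else 0))"
        using that by (intro sum.cong) auto
      then show ?thesis
        unfolding g' using that by simp
    qed
    obtain s where s: "\<And>y. y \<in> points Y \<Longrightarrow> (\<Sum>z\<in>points Y. c (Inr (rel Y y z))) = s"
      using Y.rowsum_const[of "\<lambda>i. c (Inr i)"] by blast
    obtain t where t: "\<And>y. y \<in> points Y \<Longrightarrow> (\<Sum>z\<in>points Y. d (Inr (rel Y z y))) = t"
      using Y.colsum_const[of "\<lambda>i. d (Inr i)"] by blast
    let ?n = "of_nat (card (points Y)) :: complex"
    define h1 where "h1 i = ?n * e i + s * d (Inl i) + c (Inl i) * t" for i
    define h2 where "h2 j = ?n * e (id_index X) + g j" for j
    have "matrix_prod W M N z z' = case_sum h1 h2 (rel W z z')"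
      if z: "z \<in> points W" and z': "z' \<in> points W" for z z'
    proof -
      obtain x y x' y' where zz: "z = (x, y)" "z' = (x', y')" by (cases z, cases z')
      have x: "x \<in> points X" "x' \<in> points X" and y: "y \<in> points Y" "y' \<in> points Y"
        using z z' zz by auto
      have C: "c (rel W z (u, v)) = (if u = x then c (Inr (rel Y y v)) else 0) + cX (rel X x u)"
        if "u \<in> points X" for u v
        using that x X.rel_eq_id_index_iff by (auto simp: zz cX_def)
      have D: "d (rel W (u, v) z') = (if u = x' then d (Inr (rel Y v y')) else 0) + dX (rel X u x')"
        if "u \<in> points X" for u v
        using that x X.rel_eq_id_index_iff by (auto simp: zz dX_def)
      have "matrix_prod W M N z z' = (\<Sum>w\<in>points X \<times> points Y. c (rel W z w) * d (rel W w z'))"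
        unfolding matrix_prod_def using z z' by (intro sum.cong) (auto simp: c d)
      also have "\<dots> = (\<Sum>u\<in>points X. \<Sum>v\<in>points Y. c (rel W z (u, v)) * d (rel W (u, v) z'))"
        by (simp add: sum.cartesian_product del: wreath_scheme_simps)
      also have "\<dots> = (\<Sum>u\<in>points X. \<Sum>v\<in>points Y.
          (if u = x then if u = x' then c (Inr (rel Y y v)) * d (Inr (rel Y v y')) else 0 else 0)
          + (if u = x then c (Inr (rel Y y v)) * dX (rel X u x') else 0)
          + (if u = x' then cX (rel X x u) * d (Inr (rel Y v y')) else 0)
          + cX (rel X x u) * dX (rel X u x'))"
        by (intro sum.cong refl) (simp add: C D algebra_simps del: wreath_scheme_simps)
      also have "\<dots> = (\<Sum>u\<in>points X.
          (if u = x then if u = x' then g (rel Y y y') else 0 else 0)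
          + (if u = x then s * dX (rel X u x') else 0)
          + (if u = x' then cX (rel X x u) * t else 0)
          + ?n * (cX (rel X x u) * dX (rel X u x')))"
        using s[OF y(1)] t[OF y(2)] g[OF y]
        by (intro sum.cong refl) 
           (simp add: sum.distrib flip: sum_distrib_left sum_distrib_right)
      also have "\<dots> = (if x = x' then g (rel Y y y') else 0) + s * dX (rel X x x')
          + cX (rel X x x') * t + ?n * e (rel X x x')"
        using x X.finite_points by (simp add: sum.distrib e flip: sum_distrib_left)
      also have "\<dots> = case_sum h1 h2 (rel W z z')"
        using x X.rel_eq_id_index_iff[of x x'] by (auto simp: zz h1_def h2_def cX_def dX_def)
      finally show ?thesis .
    qed
    moreover have "matrix_prod W M N z z' = 0" if "z \<notin> points W \<or> z' \<notin> points W" for z z'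
      unfolding matrix_prod_def using that by (intro sum.neutral) (auto simp: c d)
    ultimately have "\<forall>z z'. matrix_prod W M N z z' =
        (if z \<in> points W \<and> z' \<in> points W then case_sum h1 h2 (rel W z z') else 0)"
      by meson
    then show ?thesis
      unfolding iff by blast
  qed
qed

lemma Aut_same_fibre:
  assumes \<phi>: "(f, \<sigma>) \<in> carrier (Aut W)"
    and x: "x \<in> points X" and y: "y \<in> points Y" "y' \<in> points Y"
  shows "fst (f (x, y)) = fst (f (x, y'))"
proof (rule ccontr)
  assume ne: "fst (f (x, y)) \<noteq> fst (f (x, y'))"
  have f: "bij_betw f (points W) (points W)" and s: "inj_on \<sigma> (inds W)"
    and r: "\<And>z z'. z \<in> points W \<Longrightarrow> z' \<in> points W \<Longrightarrow> rel W (f z) (f z') = \<sigma> (rel W z z')"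
    using AutD[OF \<phi>] by (auto simp del: wreath_scheme_simps simp: bij_betw_def)
  have yy: "y \<noteq> y'" using ne by auto
  let ?z = "(x, y)" and ?z' = "(x, y')"
  have zW: "?z \<in> points W" "?z' \<in> points W" using x y by auto
  have fzW: "f ?z \<in> points W" "f ?z' \<in> points W"
    using zW bij_betw_apply[OF f] by blast+
  let ?A = "{w \<in> points W. rel W ?z w = rel W ?z ?z'}"
  have "?A \<subseteq> {x} \<times> (points Y - {y})"
    using y yy Y.rel_eq_id_index_iff by (auto split: if_splits) metis
  then have "card ?A \<le> card ({x} \<times> (points Y - {y}))"
    using Y.finite_points by (intro card_mono) auto
  also have "\<dots> < card (points Y)"
    using y Y.finite_points by (simp add: card_cartesian_product_singleton card_Diff1_less del: card_Diff_insert)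
  finally have less: "card ?A < card (points Y)" .
  have "{fst (f ?z')} \<times> points Y \<subseteq> f ` ?A"
  proof
    fix w' assume w': "w' \<in> {fst (f ?z')} \<times> points Y"
    then have "w' \<in> points W" using fzW by auto
    then obtain w where w: "w \<in> points W" "w' = f w"
      using f by (metis bij_betw_imp_surj_on imageE)
    have "\<sigma> (rel W ?z w) = rel W (f ?z) w'"
      using r zW w by metis
    also have "\<dots> = rel W (f ?z) (f ?z')"
      using w' ne by auto
    also have "\<dots> = \<sigma> (rel W ?z ?z')"
      using r zW by metis
    finally have "rel W ?z w = rel W ?z ?z'"
      using s zW w W.rel_in by (meson inj_onD)
    with w show "w' \<in> f ` ?A" by blast
  qed
  then have "card (points Y) \<le> card (f ` ?A)"
    using card_mono[of "f ` ?A" "{fst (f ?z')} \<times> points Y"] W.finite_points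
    by (simp add: card_cartesian_product_singleton del: wreath_scheme_simps)
  also have "\<dots> \<le> card ?A"
    using W.finite_points by (intro card_image_le) simp
  finally show False using less by simp
qed

lemma Aut_fibre_iff:
  assumes \<phi>: "(f, \<sigma>) \<in> carrier (Aut W)" and z: "z \<in> points W" and z': "z' \<in> points W"
  shows "fst (f z) = fst (f z') \<longleftrightarrow> fst z = fst z'"
proof
  assume "fst z = fst z'"
  with Aut_same_fibre[OF \<phi>, of "fst z" "snd z" "snd z'"] z z' show "fst (f z) = fst (f z')"
    by (cases z, cases z') simp
next
  assume eq: "fst (f z) = fst (f z')"
  have f: "bij_betw f (points W) (points W)"
    by (rule AutD[OF \<phi>])
  let ?F = "{fst z} \<times> points Y" and ?F' = "{fst (f z)} \<times> points Y"
  have FW: "?F \<subseteq> points W" using z by auto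
  have "f ` ?F \<subseteq> ?F'"
  proof
    fix w assume "w \<in> f ` ?F"
    then obtain v where v: "v \<in> ?F" "w = f v" by blast
    then have "f v \<in> points W" using FW bij_betw_apply[OF f] by blast
    moreover have "fst (f v) = fst (f z)"
      using Aut_same_fibre[OF \<phi>, of "fst z" "snd v" "snd z"] v z by (cases z, cases v) simp
    ultimately show "w \<in> ?F'" using v by (auto simp: mem_Times_iff)
  qed
  moreover have "card (f ` ?F) = card ?F'"
    using f FW by (subst card_image) (auto simp: bij_betw_def card_cartesian_product_singleton intro: inj_on_subset)
  ultimately have "f ` ?F = ?F'"
    using Y.finite_points by (intro card_subset_eq) auto
  moreover have "f z' \<in> ?F'"
    using eq bij_betw_apply[OF f z'] by (auto simp: mem_Times_iff)
  ultimately have "f z' \<in> f ` ?F" by (simp only:)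
  then obtain w where w: "w \<in> ?F" "f z' = f w" by (rule imageE)
  have "inj_on f (points W)" using f by (rule bij_betw_imp_inj_on)
  then have "z' = w"
    using w(2) z' FW w(1) by (rule inj_onD[OF _ _ _ subsetD])
  then show "fst z = fst z'" using \<open>w \<in> ?F\<close> by auto
qed

lemma ex1_base_aut:
  assumes \<phi>: "\<phi> \<in> carrier (Aut W)"
  shows "\<exists>!g. g \<in> carrier (Aut X) \<and> (\<forall>z\<in>points W. fst (fst \<phi> z) = fst g (fst z))"
proof (rule ex_ex1I)
  obtain f \<sigma> where fs: "\<phi> = (f, \<sigma>)" by (cases \<phi>)
  note \<phi>' = \<phi>[unfolded fs]
  obtain y0 where y0: "y0 \<in> points Y" using Y.points_nonempty by blast
  define p where "p = (\<lambda>x\<in>points X. fst (f (x, y0)))"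
  define s where "s = (\<lambda>i\<in>inds X. if i = id_index X then i else projl (\<sigma> (Inl i)))"
  have f: "bij_betw f (points W) (points W)"
    and r: "\<And>z z'. z \<in> points W \<Longrightarrow> z' \<in> points W \<Longrightarrow> rel W (f z) (f z') = \<sigma> (rel W z z')"
    using AutD[OF \<phi>'] by blast+
  have fX: "fst (f (x, y0)) \<in> points X" if "x \<in> points X" for x
    using bij_betw_apply[OF f, of "(x, y0)"] that y0 by (auto simp: mem_Times_iff)
  have inj: "inj_on p (points X)"
  proof (rule inj_onI)
    fix x x' assume "x \<in> points X" "x' \<in> points X" "p x = p x'"
    then show "x = x'"
      using Aut_fibre_iff[OF \<phi>', of "(x, y0)" "(x', y0)"] y0 by (simp add: p_def)
  qed
  have "p ` points X \<subseteq> points X"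
    using fX by (auto simp: p_def)
  then have bij: "bij_betw p (points X) (points X)"
    using inj X.finite_points by (simp add: bij_betw_def endo_inj_surj)
  have "rel X (p x) (p x') = s (rel X x x')" if x: "x \<in> points X" "x' \<in> points X" for x x'
  proof (cases "x = x'")
    case True
    then have "rel X (p x) (p x') = id_index X" "rel X x x' = id_index X"
      using x fX X.rel_eq_id_index_iff by (simp_all add: p_def)
    then show ?thesis using X.id_index_in by (simp add: s_def)
  next
    case False
    then have "fst (f (x, y0)) \<noteq> fst (f (x', y0))"
      using Aut_fibre_iff[OF \<phi>', of "(x, y0)" "(x', y0)"] x y0 by simp
    then have "\<sigma> (Inl (rel X x x')) = Inl (rel X (p x) (p x'))"
      using r[of "(x, y0)" "(x', y0)"] False x y0 by (simp add: p_def)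
    moreover have "rel X x x' \<noteq> id_index X" "rel X x x' \<in> inds X"
      using X.rel_eq_id_index_iff X.rel_in x False by auto
    ultimately show ?thesis by (simp add: s_def)
  qed
  then have "(p, s) \<in> carrier (Aut X)"
    by (intro X.AutI bij) (auto simp: p_def s_def)
  moreover have "\<forall>z\<in>points W. fst (fst \<phi> z) = fst (p, s) (fst z)"
  proof
    fix z assume z: "z \<in> points W"
    then show "fst (fst \<phi> z) = fst (p, s) (fst z)"
      using Aut_fibre_iff[OF \<phi>' z, of "(fst z, y0)"] y0 by (simp add: fs p_def mem_Times_iff)
  qed
  ultimately show "\<exists>g. g \<in> carrier (Aut X) \<and> (\<forall>z\<in>points W. fst (fst \<phi> z) = fst g (fst z))"
    by blast
next
  fix g h
  assume g: "g \<in> carrier (Aut X) \<and> (\<forall>z\<in>points W. fst (fst \<phi> z) = fst g (fst z))"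
    and h: "h \<in> carrier (Aut X) \<and> (\<forall>z\<in>points W. fst (fst \<phi> z) = fst h (fst z))"
  obtain y0 where y0: "y0 \<in> points Y" using Y.points_nonempty by blast
  have "fst g x = fst h x" if "x \<in> points X" for x
  proof -
    have "(x, y0) \<in> points W" using that y0 by simp
    then have "fst (fst \<phi> (x, y0)) = fst g (fst (x, y0))" "fst (fst \<phi> (x, y0)) = fst h (fst (x, y0))"
      using g h by blast+
    then show ?thesis by simp
  qed
  then show "g = h"
    using g h by (intro X.Aut_eqI) blast+
qed

lemma base_aut:
  assumes "\<phi> \<in> carrier (Aut W)"
  shows base_aut_in: "base_aut X Y \<phi> \<in> carrier (Aut X)"
    and base_aut_apply:
      "x \<in> points X \<Longrightarrow> y \<in> points Y \<Longrightarrow> fst (fst \<phi> (x, y)) = fst (base_aut X Y \<phi>) x"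
proof -
  have *: "base_aut X Y \<phi> \<in> carrier (Aut X) \<and>
      (\<forall>z\<in>points W. fst (fst \<phi> z) = fst (base_aut X Y \<phi>) (fst z))"
    unfolding base_aut_def by (rule theI'[OF ex1_base_aut[OF assms]])
  show "base_aut X Y \<phi> \<in> carrier (Aut X)"
    using * by (rule conjunct1)
  show "fst (fst \<phi> (x, y)) = fst (base_aut X Y \<phi>) x" if "x \<in> points X" "y \<in> points Y"
    using bspec[OF conjunct2[OF *], of "(x, y)"] that by simp
qed

lemma base_aut_eqI:
  assumes "\<phi> \<in> carrier (Aut W)" "g \<in> carrier (Aut X)"
    and "\<And>x y. x \<in> points X \<Longrightarrow> y \<in> points Y \<Longrightarrow> fst (fst \<phi> (x, y)) = fst g x"
  shows "base_aut X Y \<phi> = g"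
  unfolding base_aut_def
proof (rule the1_equality[OF ex1_base_aut[OF assms(1)]])
  show "g \<in> carrier (Aut X) \<and> (\<forall>z\<in>points W. fst (fst \<phi> z) = fst g (fst z))"
  proof (intro conjI ballI assms(2))
    fix z assume "z \<in> points W"
    then have "fst z \<in> points X" "snd z \<in> points Y" by (simp_all add: mem_Times_iff)
    from assms(3)[OF this] show "fst (fst \<phi> z) = fst g (fst z)" by (simp only: prod.collapse)
  qed
qed

lemma base_aut_hom: "base_aut X Y \<in> hom (Aut W) (Aut X)"
proof (rule homI)
  interpret AW: group "Aut W" by (rule W.group_Aut)
  interpret AX: group "Aut X" by (rule X.group_Aut)
  show "base_aut X Y \<phi> \<in> carrier (Aut X)" if "\<phi> \<in> carrier (Aut W)" for \<phi>
    using that by (rule base_aut_in)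
  fix \<phi> \<psi> assume \<phi>: "\<phi> \<in> carrier (Aut W)" and \<psi>: "\<psi> \<in> carrier (Aut W)"
  show "base_aut X Y (\<phi> \<otimes>\<^bsub>Aut W\<^esub> \<psi>) = base_aut X Y \<phi> \<otimes>\<^bsub>Aut X\<^esub> base_aut X Y \<psi>"
  proof (rule base_aut_eqI)
    show "\<phi> \<otimes>\<^bsub>Aut W\<^esub> \<psi> \<in> carrier (Aut W)" using \<phi> \<psi> by simp
    show "base_aut X Y \<phi> \<otimes>\<^bsub>Aut X\<^esub> base_aut X Y \<psi> \<in> carrier (Aut X)"
      using \<phi> \<psi> base_aut_in by simp
    fix x y assume x: "x \<in> points X" and y: "y \<in> points Y"
    obtain f \<sigma> g \<tau> where fg: "\<phi> = (f, \<sigma>)" "\<psi> = (g, \<tau>)" by (cases \<phi>, cases \<psi>)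
    obtain p s q t where pq: "base_aut X Y \<phi> = (p, s)" "base_aut X Y \<psi> = (q, t)"
      by (metis surj_pair)
    have gz: "g (x, y) \<in> points W"
      using \<psi> x y unfolding fg in_Aut_iff by (auto dest!: Bij_imp_funcset)
    have "fst (g (x, y)) = q x"
      using base_aut_apply[OF \<psi> x y] by (simp add: fg pq[unfolded fg])
    moreover have "fst (f (g (x, y))) = p (fst (g (x, y)))"
      using base_aut_apply[OF \<phi>, of "fst (g (x, y))" "snd (g (x, y))"] gz
      by (simp add: fg pq[unfolded fg] mem_Times_iff)
    ultimately show "fst (fst (\<phi> \<otimes>\<^bsub>Aut W\<^esub> \<psi>) (x, y)) = fst (base_aut X Y \<phi> \<otimes>\<^bsub>Aut X\<^esub> base_aut X Y \<psi>) x"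
      using \<phi> \<psi> base_aut_in[OF \<phi>] base_aut_in[OF \<psi>] x y
      by (simp add: fg pq[unfolded fg] Aut_mult compose_def)
  qed
qed

end

lemma group_semidirect_product:
  assumes "group N" "group H"
    and closed: "\<And>h n. h \<in> carrier H \<Longrightarrow> n \<in> carrier N \<Longrightarrow> \<theta> h n \<in> carrier N"
    and hom: "\<And>h n n'. h \<in> carrier H \<Longrightarrow> n \<in> carrier N \<Longrightarrow> n' \<in> carrier N \<Longrightarrow>
          \<theta> h (n \<otimes>\<^bsub>N\<^esub> n') = \<theta> h n \<otimes>\<^bsub>N\<^esub> \<theta> h n'"
    and act: "\<And>h h' n. h \<in> carrier H \<Longrightarrow> h' \<in> carrier H \<Longrightarrow> n \<in> carrier N \<Longrightarrow>
          \<theta> (h \<otimes>\<^bsub>H\<^esub> h') n = \<theta> h (\<theta> h' n)"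
    and one: "\<And>n. n \<in> carrier N \<Longrightarrow> \<theta> \<one>\<^bsub>H\<^esub> n = n"
  shows "group (semidirect_product N H \<theta>)"
proof -
  interpret N: group N by fact
  interpret H: group H by fact
  show ?thesis
  proof (rule groupI)
    fix a assume "a \<in> carrier (semidirect_product N H \<theta>)"
    then obtain n h where a: "a = (n, h)" "n \<in> carrier N" "h \<in> carrier H"
      by (auto simp: semidirect_product_def)
    show "\<exists>b\<in>carrier (semidirect_product N H \<theta>).
        b \<otimes>\<^bsub>semidirect_product N H \<theta>\<^esub> a = \<one>\<^bsub>semidirect_product N H \<theta>\<^esub>"
      using a closed
      by (intro bexI[of _ "(inv\<^bsub>N\<^esub> (\<theta> (inv\<^bsub>H\<^esub> h) n), inv\<^bsub>H\<^esub> h)"])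
         (auto simp: semidirect_product_def)
  qed (auto simp: semidirect_product_def closed hom act one N.m_assoc H.m_assoc)
qed

lemma group_wreath_group:
  assumes G: "group G" and "group_action H \<Omega> \<alpha>"
  shows "group (wreath_group G \<Omega> H \<alpha>)"
proof -
  interpret A: group_action H \<Omega> \<alpha> by fact
  interpret gh: group_hom H "BijGroup \<Omega>" \<alpha> by (rule A.group_hom)
  interpret G: group G by fact
  have inv_in: "\<alpha> (inv\<^bsub>H\<^esub> h) \<omega> \<in> \<Omega>" if "h \<in> carrier H" "\<omega> \<in> \<Omega>" for h \<omega>
    using that A.element_image gh.G.inv_closed by blast
  show ?thesis
    unfolding wreath_group_def
  proof (rule group_semidirect_product)
    show "group (product_group \<Omega> (\<lambda>_. G))" by (simp add: G)
    show "group H" by (rule gh.G.is_group)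
  next
    fix h n assume "h \<in> carrier H" "n \<in> carrier (product_group \<Omega> (\<lambda>_. G))"
    then show "(\<lambda>\<omega>\<in>\<Omega>. n (\<alpha> (inv\<^bsub>H\<^esub> h) \<omega>)) \<in> carrier (product_group \<Omega> (\<lambda>_. G))"
      using inv_in by (auto simp: PiE_iff)
  next
    fix h h' n assume h: "h \<in> carrier H" "h' \<in> carrier H"
      and "n \<in> carrier (product_group \<Omega> (\<lambda>_. G))"
    have "\<alpha> (inv\<^bsub>H\<^esub> (h \<otimes>\<^bsub>H\<^esub> h')) \<omega> = \<alpha> (inv\<^bsub>H\<^esub> h') (\<alpha> (inv\<^bsub>H\<^esub> h) \<omega>)" if "\<omega> \<in> \<Omega>" for \<omega>
      using A.composition_rule[OF that gh.G.inv_closed[OF h(2)] gh.G.inv_closed[OF h(1)]]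
      unfolding gh.G.inv_mult_group[OF h] .
    then show "(\<lambda>\<omega>\<in>\<Omega>. n (\<alpha> (inv\<^bsub>H\<^esub> (h \<otimes>\<^bsub>H\<^esub> h')) \<omega>)) =
        (\<lambda>\<omega>\<in>\<Omega>. (\<lambda>\<omega>\<in>\<Omega>. n (\<alpha> (inv\<^bsub>H\<^esub> h') \<omega>)) (\<alpha> (inv\<^bsub>H\<^esub> h) \<omega>))"
      using h inv_in by (auto intro!: restrict_ext)
  next
    fix n assume "n \<in> carrier (product_group \<Omega> (\<lambda>_. G))"
    then show "(\<lambda>\<omega>\<in>\<Omega>. n (\<alpha> (inv\<^bsub>H\<^esub> \<one>\<^bsub>H\<^esub>) \<omega>)) = n"
      by (auto simp: PiE_iff fun_eq_iff extensional_def restrict_def BijGroup_def)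
  qed (auto simp: inv_in simp del: gh.hom_inv intro!: restrict_ext)
qed

lemma (in association_scheme) Aut_action: "group_action (Aut S) (points S) fst"
proof -
  have "fst \<in> hom (Aut S) (BijGroup (points S))"
    by (rule homI) (auto simp: in_Aut_iff BijGroup_def Aut_mult)
  then show ?thesis
    by (simp add: group_action_def group_hom_def group_hom_axioms_def group_Aut group_BijGroup)
qed

lemma (in association_scheme) fibre_association_scheme: "association_scheme (fibre S (a :: 'a))"
proof
  let ?F = "fibre S a"
  show fi: "finite (inds ?F)" and "finite (points ?F)"
    using finite_inds finite_points by auto
  have "(\<lambda>(x, y). rel ?F x y) ` (points ?F \<times> points ?F) = (\<lambda>(x, y). rel S x y) ` (points S \<times> points S)"
    by force
  also have "\<dots> = inds ?F" by (simp add: rel_surj)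
  finally show surj: "(\<lambda>(x, y). rel ?F x y) ` (points ?F \<times> points ?F) = inds ?F" .
  note iff = adj_span_iff[OF fi surj]
  show "\<exists>i\<in>inds ?F. adj ?F i = id_matrix ?F"
    using id_index_in rel_eq_id_index_iff
    by (intro bexI[of _ "id_index S"]) (auto simp: adj_def id_matrix_def fun_eq_iff)
  have down: "(\<lambda>x y. M (a, x) (a, y)) \<in> adj_span S" if "M \<in> adj_span ?F" for M
    using that unfolding iff in_adj_span_iff by auto
  have up: "M \<in> adj_span ?F" if M: "(\<lambda>x y. M (a, x) (a, y)) \<in> adj_span S"
    and M0: "\<And>z w. z \<notin> points ?F \<or> w \<notin> points ?F \<Longrightarrow> M z w = 0" for M
  proof -
    obtain c where "\<And>x y. M (a, x) (a, y) = (if x \<in> points S \<and> y \<in> points S then c (rel S x y) else 0)"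
      using M unfolding in_adj_span_iff by blast
    then have "M z w = (if z \<in> points ?F \<and> w \<in> points ?F then c (rel ?F z w) else 0)" for z w
      using M0[of z w] by (cases z; cases w) auto
    then show ?thesis unfolding iff by blast
  qed
  have zero: "M z w = 0" if "M \<in> adj_span ?F" "z \<notin> points ?F \<or> w \<notin> points ?F" for M z w
    using that unfolding iff by (cases z; cases w) auto
  show "(\<lambda>x y. M y x) \<in> adj_span ?F" if "M \<in> adj_span ?F" for M
    using transpose_closed[OF down[OF that]] zero[OF that] by (intro up) auto
  show "matrix_prod ?F M N \<in> adj_span ?F" if M: "M \<in> adj_span ?F" and N: "N \<in> adj_span ?F" for M N
  proof (rule up)
    have "(\<lambda>x y. matrix_prod ?F M N (a, x) (a, y)) =
        matrix_prod S (\<lambda>x y. M (a, x) (a, y)) (\<lambda>x y. N (a, x) (a, y))"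
    proof (intro ext)
      fix x y
      have "(\<Sum>z\<in>{a} \<times> points S. M (a, x) z * N z (a, y)) =
          (\<Sum>z\<in>points S. M (a, x) (a, z) * N (a, z) (a, y))"
        by (rule sum.reindex_bij_witness[of _ "Pair a" snd]) auto
      then show "matrix_prod ?F M N (a, x) (a, y) =
          matrix_prod S (\<lambda>x y. M (a, x) (a, y)) (\<lambda>x y. N (a, x) (a, y)) x y"
        by (simp add: matrix_prod_def)
    qed
    then show "(\<lambda>x y. matrix_prod ?F M N (a, x) (a, y)) \<in> adj_span S"
      using prod_closed[OF down[OF M] down[OF N]] by simp
    show "matrix_prod ?F M N z w = 0" if "z \<notin> points ?F \<or> w \<notin> points ?F" for z w
      unfolding matrix_prod_def 
    proof (rule sum.neutral, rule ballI)
      fix v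
      show "M z v * N v w = 0"
        using that zero[OF M, of z v] zero[OF N, of v w] by (auto simp del: fibre_simps)
    qed
  qed
qed

lemma (in association_scheme) fibre_ident_iso: "fibre_ident S a \<in> iso (Aut (fibre S a)) (Aut S)"
proof -
  let ?F = "fibre S a"
  interpret F: association_scheme ?F by (rule fibre_association_scheme)
  have apply_in: "fst (g (a, y)) = a" "snd (g (a, y)) \<in> points S"
    if "(g, \<tau>) \<in> carrier (Aut ?F)" "y \<in> points S" for g \<tau> y
    using that unfolding in_Aut_iff by (force dest!: Bij_imp_funcset simp: Pi_iff)+
  have closed: "fibre_ident S a \<phi> \<in> carrier (Aut S)" if \<phi>: "\<phi> \<in> carrier (Aut ?F)" for \<phi>
  proof -
    obtain g \<tau> where gt: "\<phi> = (g, \<tau>)" by (cases \<phi>)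
    note \<phi>' = \<phi>[unfolded gt]
    let ?k = "\<lambda>y\<in>points S. snd (g (a, y))"
    have g: "bij_betw g ({a} \<times> points S) ({a} \<times> points S)"
      using \<phi>' by (auto simp: in_Aut_iff Bij_def)
    have "inj_on ?k (points S)"
    proof (rule inj_onI)
      fix y y' assume y: "y \<in> points S" "y' \<in> points S" "?k y = ?k y'"
      then have "g (a, y) = g (a, y')"
        using apply_in(1)[OF \<phi>'] by (intro prod_eqI) auto
      then show "y = y'"
        using g y by (auto simp: bij_betw_def dest: inj_onD)
    qed
    moreover have "?k ` points S \<subseteq> points S"
      using apply_in(2)[OF \<phi>'] by auto
    ultimately have "bij_betw ?k (points S) (points S)"
      using finite_points by (simp add: bij_betw_def endo_inj_surj)
    then have "(?k, \<tau>) \<in> carrier (Aut S)"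
      using \<phi>' by (intro AutI) (auto simp: in_Aut_iff Bij_def)
    then show ?thesis by (simp add: gt fibre_ident_def)
  qed
  have "fibre_ident S a \<in> hom (Aut ?F) (Aut S)"
  proof (rule homI)
    fix \<phi> \<psi> assume \<phi>: "\<phi> \<in> carrier (Aut ?F)" and \<psi>: "\<psi> \<in> carrier (Aut ?F)"
    obtain g \<tau> h \<sigma> where gh: "\<phi> = (g, \<tau>)" "\<psi> = (h, \<sigma>)" by (cases \<phi>, cases \<psi>)
    have h: "h (a, y) = (a, snd (h (a, y)))" "snd (h (a, y)) \<in> points S" if "y \<in> points S" for y
      using apply_in[OF \<psi>[unfolded gh] that] by (auto simp: prod_eq_iff)
    show "fibre_ident S a (\<phi> \<otimes>\<^bsub>Aut ?F\<^esub> \<psi>) = fibre_ident S a \<phi> \<otimes>\<^bsub>Aut S\<^esub> fibre_ident S a \<psi>"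
      using closed[OF \<phi>] closed[OF \<psi>] \<phi> \<psi> h
      by (auto simp: gh fibre_ident_def Aut_mult compose_def fun_eq_iff)
  qed (rule closed)
  moreover have "inj_on (fibre_ident S a) (carrier (Aut ?F))"
  proof (rule inj_onI)
    fix \<phi> \<psi> assume \<phi>: "\<phi> \<in> carrier (Aut ?F)" and \<psi>: "\<psi> \<in> carrier (Aut ?F)"
      and eq: "fibre_ident S a \<phi> = fibre_ident S a \<psi>"
    obtain g \<tau> h \<sigma> where gh: "\<phi> = (g, \<tau>)" "\<psi> = (h, \<sigma>)" by (cases \<phi>, cases \<psi>)
    have "g (a, y) = h (a, y)" if "y \<in> points S" for y
      using apply_in(1)[OF \<phi>[unfolded gh] that] apply_in(1)[OF \<psi>[unfolded gh] that] eq that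
      by (auto simp: gh fibre_ident_def fun_eq_iff prod_eq_iff restrict_def split: if_splits)
    then show "\<phi> = \<psi>"
      using \<phi> \<psi> by (intro F.Aut_eqI) (auto simp: gh)
  qed
  moreover have "carrier (Aut S) \<subseteq> fibre_ident S a ` carrier (Aut ?F)"
  proof
    fix \<psi> assume \<psi>: "\<psi> \<in> carrier (Aut S)"
    obtain k \<tau> where kt: "\<psi> = (k, \<tau>)" by (cases \<psi>)
    have k: "bij_betw k (points S) (points S)" "k \<in> extensional (points S)"
      using \<psi> by (auto simp: kt in_Aut_iff Bij_def)
    let ?g = "\<lambda>z\<in>{a} \<times> points S. (a, k (snd z))"
    have "bij_betw ?g ({a} \<times> points S) ({a} \<times> points S)"
      using k(1) unfolding bij_betw_def inj_on_def by (auto simp: image_iff) (metis image_iff)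
    then have "(?g, \<tau>) \<in> carrier (Aut ?F)"
      using \<psi> by (intro F.AutI) (auto simp: kt in_Aut_iff Bij_def)
    moreover have "fibre_ident S a (?g, \<tau>) = \<psi>"
      using k(2) by (auto simp: kt fibre_ident_def fun_eq_iff extensional_def)
    ultimately show "\<psi> \<in> fibre_ident S a ` carrier (Aut ?F)" by force
  qed
  ultimately show ?thesis
    by (auto simp: iso_def bij_betw_def hom_def)
qed

end

theory Submission
  imports Defs
begin

text \<open>
  An automorphism of \<open>X \<leftthreetimes> Y\<close> permutes the fibres of the projection to \<open>X\<close>, so it has the form
  \<open>(x, y) \<mapsto> (\<pi> x, f\<^sub>x y)\<close>.  Two points of one fibre are related by an index \<open>Inr j\<close> that does not
  remember the fibre.  Hence all the maps \<open>f\<^sub>x\<close> are automorphisms of \<open>Y\<close> and they all induce the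
  \<^emph>\<open>same\<close> bijection of \<open>inds Y\<close> (\<open>fibre_component_in_Aut\<close>).  Conversely, automorphisms of \<open>Y\<close>, one
  for each \<open>x\<close>, that agree on \<open>inds Y\<close> fit together to an automorphism over the identity of \<open>X\<close>
  (\<open>glue_in_base_kernel\<close>): relations between different fibres ignore \<open>y\<close>, so nothing has to be
  checked there.  This describes the kernel.

  For the embedding into the wreath product of groups, the maps \<open>f\<^sub>x\<close> satisfy the cocycle identity
  \<open>(f g)\<^sub>x = f\<^bsub>\<rho> x\<^esub> g\<^sub>x\<close>, where \<open>\<rho>\<close> is the permutation of \<open>X\<close> under \<open>g\<close>
  (\<open>fibre_component_mult\<close>).  Indexing \<open>f\<^sub>x\<close> by the fibre \<open>\<pi> x\<close> that it maps \<^emph>\<open>onto\<close> turns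
  this identity into the multiplication rule of the semidirect product, and \<open>\<pi>\<close> together with the
  maps \<open>f\<^sub>x\<close> determines the automorphism.
\<close>

section \<open>Point maps and index maps\<close>

lemma fst_Aut_mult:
  assumes "\<phi> \<in> carrier (Aut S)" "\<psi> \<in> carrier (Aut S)"
  shows "fst (\<phi> \<otimes>\<^bsub>Aut S\<^esub> \<psi>) = compose (points S) (fst \<phi>) (fst \<psi>)"
  using assms by (cases \<phi>; cases \<psi>) (simp add: Aut_mult)

lemma (in association_scheme) snd_Aut_hom: "snd \<in> hom (Aut S) (BijGroup (inds S))"
  by (rule homI) (auto simp: in_Aut_iff BijGroup_def Aut_mult)

lemma snd_fibre_ident [simp]: "snd (fibre_ident Y x \<phi>) = snd \<phi>"
  by (simp add: fibre_ident_def split: prod.split)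

section \<open>Decomposing automorphisms of the wreath product\<close>

text \<open>
  The restriction of an automorphism of \<open>X \<leftthreetimes> Y\<close> to the fibre over \<open>x\<close>, with source and target
  fibre both identified with \<open>Y\<close>.
\<close>

definition fibre_component ::
  "('y, 'j) rel_triple \<Rightarrow> (('x \<times> 'y \<Rightarrow> 'x \<times> 'y) \<times> ('i + 'j \<Rightarrow> 'i + 'j)) \<Rightarrow> 'x \<Rightarrow>
   (('y \<Rightarrow> 'y) \<times> ('j \<Rightarrow> 'j))" where
  "fibre_component Y \<phi> x =
     (\<lambda>y\<in>points Y. snd (fst \<phi> (x, y)), \<lambda>j\<in>inds Y. projr (snd \<phi> (Inr j)))"

context scheme_pair
begin

lemma Aut_W_apply:
  assumes "\<phi> \<in> carrier (Aut W)" "x \<in> points X" "y \<in> points Y"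
  shows "fst \<phi> (x, y) = (fst (base_aut X Y \<phi>) x, fst (fibre_component Y \<phi> x) y)"
  using base_aut_apply[OF assms] assms(3) by (simp add: fibre_component_def prod_eq_iff)

lemma base_aut_closed:
  assumes "\<phi> \<in> carrier (Aut W)" "x \<in> points X"
  shows "fst (base_aut X Y \<phi>) x \<in> points X"
  by (rule group_action.element_image[OF X.Aut_action base_aut_in[OF assms(1)] assms(2) refl])

text \<open>
  The map on \<open>inds Y\<close> is read off from the relations inside a single fibre.  Since it is a component
  of the map on \<open>inds W\<close>, it does not depend on \<open>x\<close>.
\<close>

lemma fibre_component_in_Aut:
  assumes \<phi>: "\<phi> \<in> carrier (Aut W)" and x: "x \<in> points X"
  shows "fibre_component Y \<phi> x \<in> carrier (Aut Y)"
proof -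
  obtain f \<sigma> where fs: "\<phi> = (f, \<sigma>)" by (cases \<phi>)
  note \<phi>' = \<phi>[unfolded fs]
  let ?g = "\<lambda>y\<in>points Y. snd (f (x, y))"
  have f: "bij_betw f (points W) (points W)" 
    and r: "\<And>z z'. z \<in> points W \<Longrightarrow> z' \<in> points W \<Longrightarrow> rel W (f z) (f z') = \<sigma> (rel W z z')"
    using AutD[OF \<phi>'] by blast+
  have "inj_on ?g (points Y)"
  proof (rule inj_onI)
    fix y y' assume y: "y \<in> points Y" "y' \<in> points Y" "?g y = ?g y'"
    have "f (x, y) = f (x, y')"
      using Aut_same_fibre[OF \<phi>' x y(1,2)] y by (simp add: prod_eq_iff)
    then show "y = y'"
      using bij_betw_imp_inj_on[OF f] x y by (auto dest: inj_onD)
  qed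
  moreover have "?g ` points Y \<subseteq> points Y"
    using bij_betw_apply[OF f] x by (auto simp: mem_Times_iff)
  ultimately have "bij_betw ?g (points Y) (points Y)"
    using Y.finite_points by (simp add: bij_betw_def endo_inj_surj)
  moreover have "rel Y (?g y) (?g y') = (\<lambda>j\<in>inds Y. projr (\<sigma> (Inr j))) (rel Y y y')"
    if y: "y \<in> points Y" "y' \<in> points Y" for y y'
  proof -
    have "\<sigma> (Inr (rel Y y y')) = Inr (rel Y (snd (f (x, y))) (snd (f (x, y'))))"
      using r[of "(x, y)" "(x, y')"] Aut_same_fibre[OF \<phi>' x y] x y by simp
    then show ?thesis using y Y.rel_in by simp
  qed
  ultimately show ?thesis
    unfolding fibre_component_def fs fst_conv snd_conv by (intro Y.AutI) auto
qed

text \<open>The cocycle identity: \<open>\<psi>\<close> first moves the fibre over \<open>x\<close>, and \<open>\<phi>\<close> acts on the fibre that it reaches.\<close>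

lemma fibre_component_mult:
  assumes \<phi>: "\<phi> \<in> carrier (Aut W)" and \<psi>: "\<psi> \<in> carrier (Aut W)" and x: "x \<in> points X"
  shows "fibre_component Y (\<phi> \<otimes>\<^bsub>Aut W\<^esub> \<psi>) x =
    fibre_component Y \<phi> (fst (base_aut X Y \<psi>) x) \<otimes>\<^bsub>Aut Y\<^esub> fibre_component Y \<psi> x"
proof (rule Y.Aut_eqI)
  interpret AW: group "Aut W" by (rule W.group_Aut)
  interpret AY: group "Aut Y" by (rule Y.group_Aut)
  let ?x = "fst (base_aut X Y \<psi>) x"
  have x': "?x \<in> points X" by (rule base_aut_closed[OF \<psi> x])
  show "fibre_component Y (\<phi> \<otimes>\<^bsub>Aut W\<^esub> \<psi>) x \<in> carrier (Aut Y)"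
    using \<phi> \<psi> x by (simp add: fibre_component_in_Aut)
  show "fibre_component Y \<phi> ?x \<otimes>\<^bsub>Aut Y\<^esub> fibre_component Y \<psi> x \<in> carrier (Aut Y)"
    using \<phi> \<psi> x x' by (simp add: fibre_component_in_Aut)
  fix y assume y: "y \<in> points Y"
  have y': "fst (fibre_component Y \<psi> x) y \<in> points Y"
    by (rule group_action.element_image[OF Y.Aut_action fibre_component_in_Aut[OF \<psi> x] y refl])
  have "fst (fibre_component Y (\<phi> \<otimes>\<^bsub>Aut W\<^esub> \<psi>) x) y = snd (fst (\<phi> \<otimes>\<^bsub>Aut W\<^esub> \<psi>) (x, y))"
    using y by (simp add: fibre_component_def)
  also have "\<dots> = fst (fibre_component Y \<phi> ?x) (fst (fibre_component Y \<psi> x) y)"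
    using x y by (simp add: fst_Aut_mult[OF \<phi> \<psi>] compose_def Aut_W_apply[OF \<psi> x y] Aut_W_apply[OF \<phi> x' y'])
  also have "\<dots> = fst (fibre_component Y \<phi> ?x \<otimes>\<^bsub>Aut Y\<^esub> fibre_component Y \<psi> x) y"
    using y by (simp add: fst_Aut_mult compose_def
        fibre_component_in_Aut[OF \<phi> x'] fibre_component_in_Aut[OF \<psi> x])
  finally show "fst (fibre_component Y (\<phi> \<otimes>\<^bsub>Aut W\<^esub> \<psi>) x) y =
      fst (fibre_component Y \<phi> ?x \<otimes>\<^bsub>Aut Y\<^esub> fibre_component Y \<psi> x) y" .
qed

lemma Aut_W_eqI:
  assumes \<phi>: "\<phi> \<in> carrier (Aut W)" and \<psi>: "\<psi> \<in> carrier (Aut W)"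
    and base: "base_aut X Y \<phi> = base_aut X Y \<psi>"
    and comp: "\<And>x. x \<in> points X \<Longrightarrow> fibre_component Y \<phi> x = fibre_component Y \<psi> x"
  shows "\<phi> = \<psi>"
proof (rule W.Aut_eqI[OF \<phi> \<psi>])
  fix z assume "z \<in> points W"
  then obtain x y where "z = (x, y)" "x \<in> points X" "y \<in> points Y" by auto
  then show "fst \<phi> z = fst \<psi> z"
    by (simp add: Aut_W_apply[OF \<phi>] Aut_W_apply[OF \<psi>] base comp)
qed

end

section \<open>Gluing automorphisms of the fibres\<close>

text \<open>
  For a family of automorphisms of \<open>Y\<close> inducing one and the same map on \<open>inds Y\<close>, any point of \<open>X\<close>
  may be used to read off that map; the choice below is therefore harmless.
\<close>

definition glue ::
  "('x, 'i) rel_triple \<Rightarrow> ('y, 'j) rel_triple \<Rightarrow> ('x \<Rightarrow> ('y \<Rightarrow> 'y) \<times> ('j \<Rightarrow> 'j)) \<Rightarrow>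
   (('x \<times> 'y \<Rightarrow> 'x \<times> 'y) \<times> ('i + 'j \<Rightarrow> 'i + 'j))" where
  "glue X Y k =
     (\<lambda>z\<in>points X \<times> points Y. (fst z, fst (k (fst z)) (snd z)),
      \<lambda>i\<in>inds (wreath_scheme X Y). map_sum id (snd (k (SOME x. x \<in> points X))) i)"

context scheme_pair
begin

lemma glue_apply:
  "x \<in> points X \<Longrightarrow> y \<in> points Y \<Longrightarrow> fst (glue X Y k) (x, y) = (x, fst (k x) y)"
  by (simp add: glue_def)

lemma in_base_kernel_iff:
  "\<phi> \<in> base_kernel X Y \<longleftrightarrow>
     \<phi> \<in> carrier (Aut W) \<and> (\<forall>x\<in>points X. \<forall>y\<in>points Y. fst (fst \<phi> (x, y)) = x)"
proof -
  have one: "\<one>\<^bsub>Aut X\<^esub> \<in> carrier (Aut X)"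
    using X.group_Aut by (simp add: group.is_monoid monoid.one_closed)
  have "base_aut X Y \<phi> = \<one>\<^bsub>Aut X\<^esub> \<longleftrightarrow>
      (\<forall>x\<in>points X. \<forall>y\<in>points Y. fst (fst \<phi> (x, y)) = x)" if \<phi>: "\<phi> \<in> carrier (Aut W)"
  proof
    assume "base_aut X Y \<phi> = \<one>\<^bsub>Aut X\<^esub>"
    then show "\<forall>x\<in>points X. \<forall>y\<in>points Y. fst (fst \<phi> (x, y)) = x"
      by (simp add: base_aut_apply[OF \<phi>] Aut_one)
  next
    assume "\<forall>x\<in>points X. \<forall>y\<in>points Y. fst (fst \<phi> (x, y)) = x"
    then show "base_aut X Y \<phi> = \<one>\<^bsub>Aut X\<^esub>"
      by (intro base_aut_eqI[OF \<phi> one]) (simp add: Aut_one)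
  qed
  then show ?thesis by (auto simp: base_kernel_def kernel_def)
qed

text \<open>
  Agreement of the index maps is exactly what makes the map on \<open>inds W\<close> well defined: the
  index \<open>Inr j\<close> occurs in every fibre.
\<close>

lemma glue_in_base_kernel:
  assumes k: "\<And>x. x \<in> points X \<Longrightarrow> k x \<in> carrier (Aut Y)"
    and \<tau>: "\<And>x. x \<in> points X \<Longrightarrow> snd (k x) = \<tau>"
  shows "glue X Y k \<in> base_kernel X Y"
proof -
  have k': "(fst (k x), \<tau>) \<in> carrier (Aut Y)" if "x \<in> points X" for x
    using k[OF that] \<tau>[OF that] by (metis prod.collapse)
  note D = AutD[OF k']
  have index: "snd (k (SOME x. x \<in> points X)) = \<tau>"
    using \<tau> X.points_nonempty by (simp add: some_in_eq)
  let ?f = "\<lambda>z\<in>points X \<times> points Y. (fst z, fst (k (fst z)) (snd z))"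
  let ?\<sigma> = "\<lambda>i\<in>inds W. map_sum id \<tau> i"
  have glue: "glue X Y k = (?f, ?\<sigma>)"
    by (simp add: glue_def index)
  have "inj_on ?f (points W)"
    by (rule inj_onI) (auto dest: inj_onD[OF bij_betw_imp_inj_on[OF D(1)]])
  moreover have "?f ` points W \<subseteq> points W"
    using bij_betw_apply[OF D(1)] by auto
  ultimately have "bij_betw ?f (points W) (points W)"
    unfolding bij_betw_def using endo_inj_surj[OF W.finite_points] by blast
  moreover have "rel W (?f z) (?f z') = ?\<sigma> (rel W z z')"
    if z: "z \<in> points W" "z' \<in> points W" for z z'
  proof -
    have "?\<sigma> (rel W z z') = map_sum id \<tau> (rel W z z')"
      by (rule restrict_apply'[OF W.rel_in[OF z]])
    also have "\<dots> = rel W (?f z) (?f z')"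
      using z D(3) by (auto simp: mem_Times_iff)
    finally show ?thesis by (rule sym)
  qed
  ultimately have "glue X Y k \<in> carrier (Aut W)"
    unfolding glue by (intro W.AutI) auto
  then show ?thesis
    by (simp add: in_base_kernel_iff glue_apply)
qed

section \<open>The kernel of the action on the fibres\<close>

lemma fibre_group: "group (Aut (fibre Y x))"
  by (rule association_scheme.group_Aut[OF Y.fibre_association_scheme])

lemma fibre_ident_in:
  "\<phi> \<in> carrier (Aut (fibre Y x)) \<Longrightarrow> fibre_ident Y x \<phi> \<in> carrier (Aut Y)"
  using Y.fibre_ident_iso[of x] by (auto simp: iso_def hom_def)

text \<open>
  The index bijection common to all members of a family is automatically induced by an
  automorphism of \<open>Y\<close>, because \<open>X\<close> has a point.
\<close>

lemma in_Union_fibre_aut_families_iff: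
  "k \<in> (\<Union>\<tau>\<in>index_bijections Y. fibre_aut_families X Y \<tau>) \<longleftrightarrow>
     k \<in> (\<Pi>\<^sub>E x\<in>points X. carrier (Aut (fibre Y x))) \<and> (\<exists>\<tau>. \<forall>x\<in>points X. snd (k x) = \<tau>)"
proof
  assume "k \<in> (\<Union>\<tau>\<in>index_bijections Y. fibre_aut_families X Y \<tau>)"
  then show "k \<in> (\<Pi>\<^sub>E x\<in>points X. carrier (Aut (fibre Y x))) \<and> (\<exists>\<tau>. \<forall>x\<in>points X. snd (k x) = \<tau>)"
    unfolding fibre_aut_families_def Aut_over_def by fast
next
  assume "k \<in> (\<Pi>\<^sub>E x\<in>points X. carrier (Aut (fibre Y x))) \<and> (\<exists>\<tau>. \<forall>x\<in>points X. snd (k x) = \<tau>)"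
  then obtain \<tau> where k: "k \<in> (\<Pi>\<^sub>E x\<in>points X. carrier (Aut (fibre Y x)))"
    and \<tau>: "\<And>x. x \<in> points X \<Longrightarrow> snd (k x) = \<tau>" by blast
  obtain x where x: "x \<in> points X" using X.points_nonempty by blast
  have "\<tau> \<in> index_bijections Y"
    unfolding index_bijections_def
    using fibre_ident_in[OF PiE_mem[OF k x]] \<tau>[OF x] by (metis image_eqI snd_fibre_ident)
  moreover have "k \<in> fibre_aut_families X Y \<tau>"
    using k \<tau> by (auto simp: fibre_aut_families_def Aut_over_def PiE_iff)
  ultimately show "k \<in> (\<Union>\<tau>\<in>index_bijections Y. fibre_aut_families X Y \<tau>)" by blast
qed

lemma subgroup_fibre_aut_families:
  "subgroup (\<Union>\<tau>\<in>index_bijections Y. fibre_aut_families X Y \<tau>)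
     (product_group (points X) (\<lambda>x. Aut (fibre Y x)))" (is "subgroup ?U ?G")
proof (rule group.subgroupI)
  interpret G: group ?G by (simp add: fibre_group)
  have hom: "snd \<in> hom (Aut (fibre Y x)) (BijGroup (inds Y))" for x :: 'x
    using association_scheme.snd_Aut_hom[OF Y.fibre_association_scheme, of x] by simp
  note iff = in_Union_fibre_aut_families_iff
  show "group ?G" by (rule G.is_group)
  show "?U \<subseteq> carrier ?G"
    using iff by (auto simp del: UN_iff)
  have "\<one>\<^bsub>?G\<^esub> \<in> ?U"
    unfolding iff using G.one_closed by (auto simp: Aut_one)
  then show "?U \<noteq> {}" by blast
  fix k assume k: "k \<in> ?U"
  then obtain \<tau> where kP: "k \<in> carrier ?G" and \<tau>: "\<And>x. x \<in> points X \<Longrightarrow> snd (k x) = \<tau>"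
    unfolding iff by auto
  have kx: "k x \<in> carrier (Aut (fibre Y x))" if "x \<in> points X" for x
    using kP that by auto
  have inv: "inv\<^bsub>?G\<^esub> k = (\<lambda>x\<in>points X. inv\<^bsub>Aut (fibre Y x)\<^esub> k x)"
    using kP by (intro inv_product_group) (simp_all add: fibre_group)
  have "snd (inv\<^bsub>Aut (fibre Y x)\<^esub> k x) = inv\<^bsub>BijGroup (inds Y)\<^esub> \<tau>" if "x \<in> points X" for x
  proof -
    interpret group_hom "Aut (fibre Y x)" "BijGroup (inds Y)" snd
      using hom by (simp add: group_hom_def group_hom_axioms_def fibre_group group_BijGroup)
    show ?thesis using hom_inv[OF kx[OF that]] \<tau>[OF that] by simp
  qed
  then have "\<forall>x\<in>points X. snd ((inv\<^bsub>?G\<^esub> k) x) = inv\<^bsub>BijGroup (inds Y)\<^esub> \<tau>"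
    by (simp add: inv)
  then show "inv\<^bsub>?G\<^esub> k \<in> ?U"
    unfolding iff using G.inv_closed[OF kP] by auto
  fix l assume "l \<in> ?U"
  then obtain \<tau>' where lP: "l \<in> carrier ?G" and \<tau>': "\<And>x. x \<in> points X \<Longrightarrow> snd (l x) = \<tau>'"
    unfolding iff by auto
  have "snd (k x \<otimes>\<^bsub>Aut (fibre Y x)\<^esub> l x) = \<tau> \<otimes>\<^bsub>BijGroup (inds Y)\<^esub> \<tau>'" if "x \<in> points X" for x
    using hom_mult[OF hom kx[OF that], of "l x"] lP \<tau>[OF that] \<tau>'[OF that] that by auto
  then have "\<forall>x\<in>points X. snd ((k \<otimes>\<^bsub>?G\<^esub> l) x) = \<tau> \<otimes>\<^bsub>BijGroup (inds Y)\<^esub> \<tau>'"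
    by simp
  then show "k \<otimes>\<^bsub>?G\<^esub> l \<in> ?U"
    unfolding iff using G.m_closed[OF kP lP] by auto
qed

lemma disjoint_fibre_aut_families:
  "disjoint_family_on (fibre_aut_families X Y) (index_bijections Y)"
proof -
  obtain x where x: "x \<in> points X" using X.points_nonempty by blast
  have "\<tau> = \<tau>'" if "k \<in> fibre_aut_families X Y \<tau>" "k \<in> fibre_aut_families X Y \<tau>'" for k \<tau> \<tau>'
    using that x by (auto simp: fibre_aut_families_def Aut_over_def dest!: PiE_mem[OF _ x])
  then show ?thesis by (auto simp: disjoint_family_on_def)
qed

text \<open>
  An automorphism of \<open>W\<close> is determined by its action on points, so the homomorphism property and
  injectivity can be checked one fibre at a time, where both come from \<open>fibre_ident\<close> being an
  isomorphism.  For surjectivity, an element of the kernel is glued from its fibre components.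
\<close>

lemma glue_iso:
  "(\<lambda>k. glue X Y (\<lambda>x. fibre_ident Y x (k x))) \<in> iso
     ((product_group (points X) (\<lambda>x. Aut (fibre Y x)))
        \<lparr>carrier := \<Union>\<tau>\<in>index_bijections Y. fibre_aut_families X Y \<tau>\<rparr>)
     ((Aut W)\<lparr>carrier := base_kernel X Y\<rparr>)"
  (is "?\<Phi> \<in> iso (?G\<lparr>carrier := ?U\<rparr>) _")
proof -
  interpret AW: group "Aut W" by (rule W.group_Aut)
  interpret U: subgroup ?U ?G by (rule subgroup_fibre_aut_families)
  note iff = in_Union_fibre_aut_families_iff
  have kx: "k x \<in> carrier (Aut (fibre Y x))" if "k \<in> ?U" "x \<in> points X" for k x
    using that unfolding iff by blast
  have ident: "fibre_ident Y x (k x) \<in> carrier (Aut Y)" if "k \<in> ?U" "x \<in> points X" for k x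
    by (rule fibre_ident_in[OF kx[OF that]])
  have in_kernel: "?\<Phi> k \<in> base_kernel X Y" if k: "k \<in> ?U" for k
  proof -
    obtain \<tau> where "\<forall>x\<in>points X. snd (k x) = \<tau>" using k unfolding iff by blast
    then show ?thesis using ident[OF k] by (intro glue_in_base_kernel[of _ \<tau>]) simp_all
  qed
  then have in_Aut: "?\<Phi> k \<in> carrier (Aut W)" if "k \<in> ?U" for k
    using that unfolding in_base_kernel_iff by blast
  have mult: "?\<Phi> (k \<otimes>\<^bsub>?G\<^esub> l) = ?\<Phi> k \<otimes>\<^bsub>Aut W\<^esub> ?\<Phi> l" if k: "k \<in> ?U" and l: "l \<in> ?U" for k l
  proof (rule W.Aut_eqI)
    show "?\<Phi> (k \<otimes>\<^bsub>?G\<^esub> l) \<in> carrier (Aut W)"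
      using U.m_closed[OF k l] by (rule in_Aut)
    show "?\<Phi> k \<otimes>\<^bsub>Aut W\<^esub> ?\<Phi> l \<in> carrier (Aut W)"
      using in_Aut k l by blast
    fix z assume "z \<in> points W"
    then obtain x y where z: "z = (x, y)" and x: "x \<in> points X" and y: "y \<in> points Y" by auto
    have "fibre_ident Y x (k x \<otimes>\<^bsub>Aut (fibre Y x)\<^esub> l x) =
        fibre_ident Y x (k x) \<otimes>\<^bsub>Aut Y\<^esub> fibre_ident Y x (l x)"
      using Y.fibre_ident_iso[of x] kx[OF k x] kx[OF l x] by (simp add: iso_def hom_mult)
    moreover have "fst (fibre_ident Y x (l x)) y \<in> points Y"
      by (rule group_action.element_image[OF Y.Aut_action ident[OF l x] y refl])
    ultimately show "fst (?\<Phi> (k \<otimes>\<^bsub>?G\<^esub> l)) z = fst (?\<Phi> k \<otimes>\<^bsub>Aut W\<^esub> ?\<Phi> l) z"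
      using x y ident[OF k x] ident[OF l x] in_Aut[OF k] in_Aut[OF l]
      by (simp add: z fst_Aut_mult compose_eq glue_apply)
  qed
  have inj: "inj_on ?\<Phi> ?U"
  proof (rule inj_onI)
    fix k l assume k: "k \<in> ?U" and l: "l \<in> ?U" and eq: "?\<Phi> k = ?\<Phi> l"
    have "k x = l x" if x: "x \<in> points X" for x
    proof -
      have "fibre_ident Y x (k x) = fibre_ident Y x (l x)"
      proof (rule Y.Aut_eqI[OF ident[OF k x] ident[OF l x]])
        fix y assume y: "y \<in> points Y"
        have "fst (?\<Phi> k) (x, y) = fst (?\<Phi> l) (x, y)" by (simp only: eq)
        then show "fst (fibre_ident Y x (k x)) y = fst (fibre_ident Y x (l x)) y"
          by (simp add: glue_apply[OF x y])
      qed
      then show ?thesis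
        using Y.fibre_ident_iso[of x] kx[OF k x] kx[OF l x]
        by (auto simp: iso_def bij_betw_def dest: inj_onD)
    qed
    then show "k = l"
      using k l unfolding iff by (blast intro: PiE_ext)
  qed
  have "base_kernel X Y \<subseteq> ?\<Phi> ` ?U"
  proof
    fix \<phi> assume "\<phi> \<in> base_kernel X Y"
    then have \<phi>: "\<phi> \<in> carrier (Aut W)"
      and fixes_fibres: "\<And>x y. x \<in> points X \<Longrightarrow> y \<in> points Y \<Longrightarrow> fst (fst \<phi> (x, y)) = x"
      unfolding in_base_kernel_iff by blast+
    have "\<exists>a\<in>carrier (Aut (fibre Y x)). fibre_ident Y x a = fibre_component Y \<phi> x"
      if "x \<in> points X" for x
      using Y.fibre_ident_iso[of x] fibre_component_in_Aut[OF \<phi> that]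
      unfolding iso_def bij_betw_def by (metis (mono_tags, lifting) imageE mem_Collect_eq)
    then obtain k where k: "\<And>x. x \<in> points X \<Longrightarrow> k x \<in> carrier (Aut (fibre Y x))"
      and k_ident: "\<And>x. x \<in> points X \<Longrightarrow> fibre_ident Y x (k x) = fibre_component Y \<phi> x"
      by metis
    let ?k = "restrict k (points X)"
    have "snd (k x) = (\<lambda>j\<in>inds Y. projr (snd \<phi> (Inr j)))" if "x \<in> points X" for x
      using arg_cong[OF k_ident[OF that], of snd] by (simp add: fibre_component_def)
    then have kU: "?k \<in> ?U"
      unfolding iff using k by auto
    have "?\<Phi> ?k = \<phi>"
    proof (rule W.Aut_eqI[OF in_Aut[OF kU] \<phi>])
      fix z assume "z \<in> points W"
      then obtain x y where z: "z = (x, y)" and x: "x \<in> points X" and y: "y \<in> points Y" by auto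
      have "fst (?\<Phi> ?k) z = (x, snd (fst \<phi> (x, y)))"
        using x y by (simp add: z glue_apply k_ident fibre_component_def)
      then show "fst (?\<Phi> ?k) z = fst \<phi> z"
        using fixes_fibres[OF x y] by (simp add: z prod_eq_iff)
    qed
    with kU show "\<phi> \<in> ?\<Phi> ` ?U" by blast
  qed
  then have "?\<Phi> ` ?U = base_kernel X Y"
    using in_kernel by blast
  with inj have "bij_betw ?\<Phi> ?U (base_kernel X Y)"
    by (simp only: bij_betw_def)
  moreover have "?\<Phi> \<in> hom (?G\<lparr>carrier := ?U\<rparr>) ((Aut W)\<lparr>carrier := base_kernel X Y\<rparr>)"
    using in_kernel mult by (intro homI) (simp_all del: UN_iff mult_product_group)
  ultimately show ?thesis
    by (simp add: iso_def)
qed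

section \<open>The embedding into the wreath product of groups\<close>

text \<open>
  The entry at \<open>x\<close> is the fibre component \<^emph>\<open>arriving\<close> at the fibre over \<open>x\<close>, not the one leaving
  it.  In the wreath product the top factor of the left argument shifts the family of the right
  argument by its inverse, and with this indexing that rule is the cocycle identity.
\<close>

lemma Aut_embedding:
  "(\<lambda>\<phi>. (\<lambda>x\<in>points X. fibre_component Y \<phi> (fst (inv\<^bsub>Aut X\<^esub> base_aut X Y \<phi>) x), base_aut X Y \<phi>))
     \<in> mon (Aut W) (wreath_group (Aut Y) (points X) (Aut X) fst)"
  (is "?\<Psi> \<in> mon _ ?G")
proof -
  interpret AW: group "Aut W" by (rule W.group_Aut)
  interpret AX: group "Aut X" by (rule X.group_Aut)
  interpret act: group_action "Aut X" "points X" fst by (rule X.Aut_action)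
  let ?b = "base_aut X Y"
  have inv_in: "fst (inv\<^bsub>Aut X\<^esub> ?b \<phi>) x \<in> points X"
    if "\<phi> \<in> carrier (Aut W)" "x \<in> points X" for \<phi> x
    by (rule act.element_image[OF AX.inv_closed[OF base_aut_in[OF that(1)]] that(2) refl])
  have closed: "?\<Psi> \<phi> \<in> carrier ?G" if "\<phi> \<in> carrier (Aut W)" for \<phi>
    using that inv_in base_aut_in fibre_component_in_Aut
    by (auto simp: wreath_group_def semidirect_product_def)
  have "?\<Psi> (\<phi> \<otimes>\<^bsub>Aut W\<^esub> \<psi>) = ?\<Psi> \<phi> \<otimes>\<^bsub>?G\<^esub> ?\<Psi> \<psi>"
    if \<phi>: "\<phi> \<in> carrier (Aut W)" and \<psi>: "\<psi> \<in> carrier (Aut W)" for \<phi> \<psi>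
  proof -
    note b = base_aut_in[OF \<phi>] base_aut_in[OF \<psi>]
    have b_mult: "?b (\<phi> \<otimes>\<^bsub>Aut W\<^esub> \<psi>) = ?b \<phi> \<otimes>\<^bsub>Aut X\<^esub> ?b \<psi>"
      by (rule hom_mult[OF base_aut_hom \<phi> \<psi>])
    have "fibre_component Y (\<phi> \<otimes>\<^bsub>Aut W\<^esub> \<psi>) (fst (inv\<^bsub>Aut X\<^esub> ?b (\<phi> \<otimes>\<^bsub>Aut W\<^esub> \<psi>)) x) =
        fibre_component Y \<phi> (fst (inv\<^bsub>Aut X\<^esub> ?b \<phi>) x) \<otimes>\<^bsub>Aut Y\<^esub>
        fibre_component Y \<psi> (fst (inv\<^bsub>Aut X\<^esub> ?b \<psi>) (fst (inv\<^bsub>Aut X\<^esub> ?b \<phi>) x))"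
      if x: "x \<in> points X" for x
    proof -
      let ?x1 = "fst (inv\<^bsub>Aut X\<^esub> ?b \<phi>) x"
      let ?x2 = "fst (inv\<^bsub>Aut X\<^esub> ?b \<psi>) ?x1"
      have x1: "?x1 \<in> points X" and x2: "?x2 \<in> points X"
        using inv_in \<phi> \<psi> x by blast+
      have "fst (inv\<^bsub>Aut X\<^esub> ?b (\<phi> \<otimes>\<^bsub>Aut W\<^esub> \<psi>)) x = ?x2"
        using act.composition_rule[OF x AX.inv_closed[OF b(2)] AX.inv_closed[OF b(1)]]
        by (simp add: b_mult AX.inv_mult_group b)
      moreover have "fst (?b \<psi>) ?x2 = ?x1"
        using act.orbit_sym_aux[OF AX.inv_closed[OF b(2)] x1 refl] b by simp
      ultimately show ?thesis
        using fibre_component_mult[OF \<phi> \<psi> x2] by simp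
    qed
    then show ?thesis
      using inv_in[OF \<phi>]
      by (auto simp: wreath_group_def semidirect_product_def b_mult intro!: restrict_ext)
  qed
  moreover have "inj_on ?\<Psi> (carrier (Aut W))"
  proof (rule inj_onI)
    fix \<phi> \<psi> assume \<phi>: "\<phi> \<in> carrier (Aut W)" and \<psi>: "\<psi> \<in> carrier (Aut W)" and eq: "?\<Psi> \<phi> = ?\<Psi> \<psi>"
    have base: "?b \<phi> = ?b \<psi>" using eq by simp
    show "\<phi> = \<psi>"
    proof (rule Aut_W_eqI[OF \<phi> \<psi> base])
      fix x assume x: "x \<in> points X"
      \<comment> \<open>The component at \<open>x\<close> is recovered as the entry at the image of \<open>x\<close> in \<open>X\<close>.\<close>
      let ?x = "fst (?b \<phi>) x"
      have "fst (inv\<^bsub>Aut X\<^esub> ?b \<phi>) ?x = x"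
        by (rule act.orbit_sym_aux[OF base_aut_in[OF \<phi>] x refl])
      moreover have "?x \<in> points X" by (rule base_aut_closed[OF \<phi> x])
      ultimately show "fibre_component Y \<phi> x = fibre_component Y \<psi> x"
        using fun_cong[OF arg_cong[OF eq, of fst], of ?x] by (simp add: base)
    qed
  qed
  ultimately show ?thesis
    using closed by (simp add: mon_def hom_def)
qed

end

theorem proposition3p3:
  fixes X :: "('x, 'i) rel_triple" and Y :: "('y, 'j) rel_triple"
  assumes "association_scheme X" and "association_scheme Y"
  shows "subgroup (\<Union>\<tau>\<in>index_bijections Y. fibre_aut_families X Y \<tau>)
           (product_group (points X) (\<lambda>x. Aut (fibre Y x))) \<and>
         disjoint_family_on (fibre_aut_families X Y) (index_bijections Y) \<and>
         (\<exists>\<Phi> \<in> iso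
             ((product_group (points X) (\<lambda>x. Aut (fibre Y x)))
                \<lparr>carrier := \<Union>\<tau>\<in>index_bijections Y. fibre_aut_families X Y \<tau>\<rparr>)
             ((Aut (wreath_scheme X Y))\<lparr>carrier := base_kernel X Y\<rparr>).
           \<forall>\<tau>\<in>index_bijections Y. \<forall>k\<in>fibre_aut_families X Y \<tau>.
             \<forall>x\<in>points X. \<forall>y\<in>points Y.
               fst (\<Phi> k) (x, y) = (x, fst (fibre_ident Y x (k x)) y)) \<and>
         (\<exists>\<Psi>. \<Psi> \<in> mon (Aut (wreath_scheme X Y))
                     (wreath_group (Aut Y) (points X) (Aut X) fst))"
proof -
  interpret scheme_pair X Y
    using assms by (simp add: scheme_pair_def)
  have "fst (glue X Y (\<lambda>x. fibre_ident Y x (k x))) (x, y) = (x, fst (fibre_ident Y x (k x)) y)"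
    if "x \<in> points X" "y \<in> points Y" for k x y
    using that by (rule glue_apply)
  then show ?thesis
    by (intro conjI subgroup_fibre_aut_families disjoint_fibre_aut_families bexI[OF _ glue_iso]
        exI[where P = "\<lambda>\<Psi>. \<Psi> \<in> mon _ _", OF Aut_embedding] ballI)
qed

end
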